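(* Let $X$ and $Y$ be (integrable, real-valued) random variables with CDFs $F_X,F_Y$, let $\alpha\in(0,1)$, $\epsilon\in[0,1]$, $\delta\in(0,0.5)$, $n\ge1$, $\eta=\sqrt{\ln(1/\delta)/(2n)}$ and $\epsilon'=\min(\epsilon+\eta,1)$. Let $Y_1,\dots,Y_n$ be i.i.d. samples from $F_Y$ with empirical CDF $\hat F_Y$. (1) Upper bound. If $F_Y(z)-F_X(z)\le\epsilon$ for all $z\in\mathbb{R}$, $P(X\le b_X)=1$ and $P(Y\le b_Y)=1$, then: (a) if $\alpha>\epsilon'$, then $P\Big(\mathrm{CVaR}_\alpha(X)\le\frac{\epsilon'}{\alpha}\max(b_X,b_Y)+(1-\frac{\epsilon'}{\alpha})\mathrm{CVaR}_{\alpha-\epsilon'}^{\hat F_Y}\Big)>1-\delta$; (b) if $\alpha\le\epsilon'$, then $\mathrm{CVaR}_\alpha(X)\le\max(b_X,b_Y)$. (2) Lower bound. If $F_X(z)-F_Y(z)\le\epsilon$ for all $z\in\mathbb{R}$, $P(X\ge a_X)=1$ and $P(Y\ge a_Y)=1$, then, with $a_{\min}=\min(a_X,a_Y)$: (a) if $\alpha+\epsilon'\le1$, then $P\Big(\mathrm{CVaR}_\alpha(X)\ge(1+\frac{\epsilon'}{\alpha})\mathrm{CVaR}_{\alpha+\epsilon'}^{\hat F_Y}-\frac{\epsilon'}{\alpha}\mathrm{CVaR}_{\epsilon'}^{\hat F_Y}\Big)>1-\delta$; (b) if $\alpha+\epsilon'>1$, then $P\Big(\mathrm{CVaR}_\alpha(X)\ge\frac1\alpha\big(\mathbb{E}_{\hat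 F_Y}[Y]-\epsilon'\,\mathrm{CVaR}_{\epsilon'}^{\hat F_Y}+(\alpha+\epsilon'-1)a_{\min}\big)\Big)>1-\delta$.
   Context: $X,Y$ have finite first absolute moments; $a_X,a_Y,b_X,b_Y$ are real numbers. $F_X(x)=P(X\le x)$, $\hat F_Y(y)=\frac1n\sum_{i=1}^n1_{Y_i\le y}$. For $\alpha\in(0,1]$, $\mathrm{CVaR}_\alpha(X)=\inf_{w\in\mathbb{R}}\{w+\frac1\alpha\mathbb{E}[(X-w)^+]\}$, with $(x)^+=\max(x,0)$. $\mathrm{CVaR}_\beta^{\hat F_Y}=\inf_{w\in\mathbb{R}}\{w+\frac1{n\beta}\sum_{i=1}^n(Y_i-w)^+\}$ is the CVaR at level $\beta\in(0,1]$ of the empirical distribution, and $\mathbb{E}_{\hat F_Y}[Y]=\frac1n\sum_{i=1}^nY_i$. *)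

theory Defs
  imports "HOL-Probability.Probability"
begin

text \<open>
  Upper-tail CVaR in the Rockafellar--Uryasev form. For an integrable random variable and
  a level in (0,1] the infimum ranges over a nonempty set that is bounded below (by the
  expectation), so the total operator \<open>Inf\<close> on the reals returns the true infimum.
\<close>

definition CVaR :: "'a measure \<Rightarrow> real \<Rightarrow> ('a \<Rightarrow> real) \<Rightarrow> real" where
  "CVaR M \<alpha> X = (INF w. w + 1 / \<alpha> * (\<integral>\<omega>. max (X \<omega> - w) 0 \<partial>M))"

text \<open>The sample points are indexed by \<open>{1..n}\<close>; values outside that range are irrelevant.\<close>

definition emp_CVaR :: "nat \<Rightarrow> (nat \<Rightarrow> real) \<Rightarrow> real \<Rightarrow> real" where
  "emp_CVaR n y \<beta> = (INF w. w + 1 / (real n * \<beta>) * (\<Sum>i=1..n. max (y i - w) 0))"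

definition emp_mean :: "nat \<Rightarrow> (nat \<Rightarrow> real) \<Rightarrow> real" where
  "emp_mean n y = 1 / real n * (\<Sum>i=1..n. y i)"

definition emp_cdf :: "nat \<Rightarrow> (nat \<Rightarrow> real) \<Rightarrow> real \<Rightarrow> real" where
  "emp_cdf n y t = 1 / real n * (\<Sum>i=1..n. indicator {..t} (y i))"

text \<open>
  The empirical quantities are the ones of the empirical distribution, that is, the law of
  \<open>y\<close> under the uniform distribution on \<open>{1..n}\<close>.
\<close>

lemma emp_CVaR_eq_CVaR:
  assumes "n \<ge> 1"
  shows "emp_CVaR n y \<beta> = CVaR (measure_pmf (map_pmf y (pmf_of_set {1..n}))) \<beta> (\<lambda>x. x)"
  using assms unfolding emp_CVaR_def CVaR_def
  by (simp add: integral_pmf_of_set mult.commute)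

lemma emp_mean_eq_expectation:
  assumes "n \<ge> 1"
  shows "emp_mean n y = measure_pmf.expectation (map_pmf y (pmf_of_set {1..n})) (\<lambda>x. x)"
  using assms unfolding emp_mean_def by (simp add: integral_pmf_of_set)

lemma emp_cdf_eq_cdf:
  assumes "n \<ge> 1"
  shows "emp_cdf n y = cdf (measure_pmf (map_pmf y (pmf_of_set {1..n})))"
proof
  fix t
  have "cdf (measure_pmf (map_pmf y (pmf_of_set {1..n}))) t
      = measure_pmf.expectation (map_pmf y (pmf_of_set {1..n})) (indicator {..t})"
    unfolding cdf_def by simp
  also have "\<dots> = emp_cdf n y t"
    unfolding integral_map_pmf emp_cdf_def
    using assms by (subst integral_pmf_of_set) simp_all
  finally show "emp_cdf n y t = cdf (measure_pmf (map_pmf y (pmf_of_set {1..n}))) t" ..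
qed

end

theory Submission
  imports Defs "HOL-Real_Asymp.Real_Asymp"
begin

text \<open>
  Both bounds come from a pointwise comparison of CDFs. Since
  \<open>E[(X - w)\<^sup>+] - E[(X - v)\<^sup>+]\<close> is the integral of \<open>1 - F_X\<close> over \<open>[w, v]\<close>, a one-sided distance
  \<open>\<epsilon>'\<close> between \<open>F_X\<close> and the empirical CDF costs at most \<open>\<epsilon>' (v - w)\<close>, and the CVaR inequalities
  follow by choosing suitable points in the Rockafellar--Uryasev infima.

  The probability enters through the one-sided Dvoretzky--Kiefer--Wolfowitz inequality with Massart's
  constant. With \<open>N_t\<close> sample points below the \<open>t\<close>-quantile, \<open>(1 + c / t) ^ N_t\<close> is a martingale when
  \<open>t\<close> decreases from 1, with initial value \<open>(1 + c) ^ n\<close>. On the boundary \<open>N_t \<ge> n (t + \<eta>)\<close> it is at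
  least \<open>(1 + c) ^ n * exp (n \<kappa>)\<close>, where a suitable \<open>c\<close> gives as \<open>\<kappa>\<close> the minimum over \<open>t\<close> of the relative
  entropy of Bernoulli laws with parameters \<open>t + \<eta>\<close> and \<open>t\<close>. By Pinsker's inequality
  \<open>\<kappa> > 2 \<eta>\<^sup>2\<close>, and this strictness makes the failure probability strictly less than \<open>\<delta>\<close>.
\<close>

section \<open>The exponent of the boundary crossing\<close>

text \<open>For fixed \<open>t\<close>, the relative entropy minus its quadratic bound vanishes at
  shift 0 and has derivative \<open>l (t + x) - l t\<close> in the shift \<open>x\<close>.
  Strictness holds because \<open>l\<close>, the logit minus \<open>4 * p\<close>, increases
  strictly: its derivative vanishes only at 1/2.\<close>

lemma binary_pinsker_strict:
  fixes t \<eta> :: real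
  assumes "0 < t" "0 < \<eta>" "t + \<eta> < 1"
  shows "2 * \<eta>\<^sup>2 < (t + \<eta>) * ln ((t + \<eta>) / t) + (1 - t - \<eta>) * ln ((1 - t - \<eta>) / (1 - t))"
proof -
  define l where "l p = ln p - ln (1 - p) - 4 * p" for p :: real
  have dl: "(l has_real_derivative (1 - 2 * p)\<^sup>2 / (p * (1 - p))) (at p)" if "0 < p" "p < 1" for p
    unfolding l_def using that
    by (auto intro!: derivative_eq_intros simp: divide_simps power2_eq_square) (simp add: algebra_simps)
  \<comment> \<open>Without 1/2 in the interior of the interval the derivative is positive there;
    \<open>l_mono\<close> splits any other interval at 1/2.\<close>
  have l_less: "l a < l b" if ab: "0 < a" "a < b" "b < 1" "b \<le> 1 / 2 \<or> 1 / 2 \<le> a" for a b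
  proof (rule DERIV_pos_imp_increasing_open[OF ab(2)])
    fix x assume "a < x" "x < b"
    then have "0 < (1 - 2 * x)\<^sup>2 / (x * (1 - x))"
      using ab by (intro divide_pos_pos) auto
    then show "\<exists>y. DERIV l x :> y \<and> 0 < y"
      using dl[of x] \<open>a < x\<close> \<open>x < b\<close> ab by auto
  next
    show "continuous_on {a..b} l"
      using ab by (intro DERIV_continuous_on[where D = "\<lambda>p. (1 - 2 * p)\<^sup>2 / (p * (1 - p))"])
        (auto intro!: DERIV_subset[OF dl])
  qed
  have l_mono: "l a < l b" if "0 < a" "a < b" "b < 1" for a b
    using l_less[of a b] l_less[of a "1/2"] l_less[of "1/2" b] that by force
  define q where "q x = (t + x) * ln ((t + x) / t) + (1 - t - x) * ln ((1 - t - x) / (1 - t)) - 2 * x\<^sup>2" for x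
  have dq: "(q has_real_derivative l (t + x) - l t) (at x)" if x: "0 \<le> x" "x \<le> \<eta>" for x
  proof -
    have *: "0 < t + x" "0 < 1 - t - x" using assms x by auto
    have q': "(q has_real_derivative ln ((t + x) / t) - ln ((1 - t - x) / (1 - t)) - 4 * x) (at x)"
      unfolding q_def using * assms x
      by (auto intro!: derivative_eq_intros) (simp add: divide_simps, (simp add: algebra_simps)?)
    have "ln ((t + x) / t) - ln ((1 - t - x) / (1 - t)) - 4 * x = l (t + x) - l t"
      using * assms x unfolding l_def by (simp add: ln_div algebra_simps)
    then show ?thesis using q' by simp
  qed
  have "q 0 < q \<eta>"
  proof (rule DERIV_pos_imp_increasing_open[OF assms(2)])
    fix x assume x: "0 < x" "x < \<eta>"
    show "\<exists>y. DERIV q x :> y \<and> 0 < y"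
      using dq[of x] l_mono[of t "t + x"] x assms by (intro exI[of _ "l (t + x) - l t"]) auto
  next
    show "continuous_on {0..\<eta>} q"
      by (intro DERIV_continuous_on[where D = "\<lambda>x. l (t + x) - l t"])
        (auto intro!: DERIV_subset[OF dq])
  qed
  moreover have "q 0 = 0" using assms by (simp add: q_def)
  ultimately show ?thesis by (simp add: q_def)
qed

text \<open>The equation says that the derivative in \<open>t\<close> of the relative entropy of
  Bernoulli(t + \<eta>) with respect to Bernoulli(t) vanishes. That derivative, \<open>D\<close>,
  tends to minus infinity at 0 through \<open>- \<eta> / t\<close> and to plus infinity at
  \<open>1 - \<eta>\<close> through the second logarithm.\<close>

lemma stationary_point:
  fixes \<eta> :: real
  assumes "0 < \<eta>" "\<eta> < 1"
  obtains t where "0 < t" "t + \<eta> < 1"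
    "ln ((t + \<eta>) / t) + ln ((1 - t) / (1 - t - \<eta>)) = \<eta> / t + \<eta> / (1 - t)"
proof -
  define D where "D t = ln ((t + \<eta>) / t) + ln ((1 - t) / (1 - t - \<eta>)) - \<eta> / t - \<eta> / (1 - t)" for t
  have "filterlim D at_bot (at_right 0)"
    unfolding D_def using assms by real_asymp
  then have "eventually (\<lambda>t. D t < 0) (at_right 0)"
    by (rule filterlim_at_bot_dense[THEN iffD1, rule_format])
  \<comment> \<open>Staying within \<open>(1 - \<eta>) / 2\<close> of each end puts \<open>x\<close>
    to the left of \<open>1 - \<eta> - y\<close>, as the intermediate value theorem
    requires.\<close>
  moreover have "eventually (\<lambda>t. t \<in> {0<..<(1 - \<eta>) / 2}) (at_right 0)"
    using assms by (intro eventually_at_right_real) auto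
  ultimately have "eventually (\<lambda>t. D t < 0 \<and> t \<in> {0<..<(1 - \<eta>) / 2}) (at_right 0)"
    by (rule eventually_conj)
  then obtain x where x: "D x < 0" "0 < x" "x < (1 - \<eta>) / 2"
    using eventually_happens'[of "at_right (0::real)"] by fastforce
  \<comment> \<open>Reflection turns the limit at the right end \<open>1 - \<eta>\<close> into a
    limit at 0 from the right.\<close>
  have "filterlim (\<lambda>s. D (1 - \<eta> - s)) at_top (at_right 0)"
    unfolding D_def using assms by real_asymp
  then have "eventually (\<lambda>t. 0 < D (1 - \<eta> - t)) (at_right 0)"
    by (rule filterlim_at_top_dense[THEN iffD1, rule_format])
  moreover have "eventually (\<lambda>t. t \<in> {0<..<(1 - \<eta>) / 2}) (at_right 0)"
    using assms by (intro eventually_at_right_real) auto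
  ultimately have "eventually (\<lambda>t. 0 < D (1 - \<eta> - t) \<and> t \<in> {0<..<(1 - \<eta>) / 2}) (at_right 0)"
    by (rule eventually_conj)
  then obtain y where y: "0 < D (1 - \<eta> - y)" "0 < y" "y < (1 - \<eta>) / 2"
    using eventually_happens'[of "at_right (0::real)"] by fastforce
  have "continuous_on {x..1 - \<eta> - y} D"
    unfolding D_def using x y assms by (intro continuous_intros) auto
  then obtain t where "x \<le> t" "t \<le> 1 - \<eta> - y" "D t = 0"
    using IVT'[of D x 0 "1 - \<eta> - y"] x y by auto
  then show ?thesis
    using that[of t] x y by (auto simp: D_def)
qed

text \<open>\<open>m\<close> starts at 0, and for positive \<open>s\<close> its derivative has the
  sign of \<open>1 - 2 * \<rho> - \<rho> * s\<close>: it first rises strictly and then never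
  increases. A positive zero lies on the second stretch, which forces the signs on both sides of it.
  In \<open>boundary_exponent\<close> this \<open>m\<close> is the derivative of the exponent, with
  \<open>s = c / t\<close>.\<close>

lemma log_rational_sign:
  fixes \<rho> s0 :: real
  defines "m \<equiv> \<lambda>s. ln (1 + s) - s * (1 + \<rho> * s) / (1 + s)"
  assumes "0 < \<rho>" "0 < s0" and zero: "m s0 = 0"
  shows "s0 \<le> s \<Longrightarrow> m s \<le> 0" and "0 \<le> s \<Longrightarrow> s \<le> s0 \<Longrightarrow> 0 \<le> m s"
proof -
  have dm: "(m has_real_derivative s * (1 - 2 * \<rho> - \<rho> * s) / (1 + s)\<^sup>2) (at s)" if "0 \<le> s" for s
  proof -
    have "(m has_real_derivative
        1 / (1 + s) - ((1 + 2 * \<rho> * s) * (1 + s) - s * (1 + \<rho> * s)) / (1 + s)\<^sup>2) (at s)"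
      unfolding m_def using that
      by (auto intro!: derivative_eq_intros simp: power2_eq_square algebra_simps)
    moreover have "1 / (1 + s) - ((1 + 2 * \<rho> * s) * (1 + s) - s * (1 + \<rho> * s)) / (1 + s)\<^sup>2
        = s * (1 - 2 * \<rho> - \<rho> * s) / (1 + s)\<^sup>2"
      using that by (simp add: divide_simps power2_eq_square) (simp add: algebra_simps)
    ultimately show ?thesis by simp
  qed
  have cont: "continuous_on {a..b} m" if "0 \<le> a" for a b
    using that by (intro DERIV_continuous_on[where D = "\<lambda>s. s * (1 - 2 * \<rho> - \<rho> * s) / (1 + s)\<^sup>2"])
      (auto intro!: DERIV_subset[OF dm])
  have m0: "m 0 = 0" by (simp add: m_def)
  \<comment> \<open>The turning point of \<open>m\<close>; it is negative for
    \<open>\<rho> > 1/2\<close>, and then \<open>up\<close> is vacuous.\<close>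
  define z where "z = (1 - 2 * \<rho>) / \<rho>"
  have up: "m a < m b" if ab: "0 \<le> a" "a < b" "b \<le> z" for a b
  proof (rule DERIV_pos_imp_increasing_open[OF ab(2) _ cont])
    fix x assume x: "a < x" "x < b"
    then have "x < z" using ab by simp
    then have "\<rho> * x < 1 - 2 * \<rho>"
      using \<open>0 < \<rho>\<close> by (simp add: z_def field_simps)
    then have "0 < x * (1 - 2 * \<rho> - \<rho> * x) / (1 + x)\<^sup>2"
      using ab x by (intro divide_pos_pos mult_pos_pos) auto
    then show "\<exists>y. DERIV m x :> y \<and> 0 < y" using dm[of x] ab x by auto
  qed (use ab in auto)
  have down: "m b \<le> m a" if ab: "0 \<le> a" "z \<le> a" "a \<le> b" for a b
  proof (rule DERIV_nonpos_imp_nonincreasing[OF ab(3)])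
    fix x assume x: "a \<le> x" "x \<le> b"
    then have "z \<le> x" using ab by simp
    then have "1 - 2 * \<rho> \<le> \<rho> * x"
      using \<open>0 < \<rho>\<close> by (simp add: z_def field_simps)
    then have "x * (1 - 2 * \<rho> - \<rho> * x) / (1 + x)\<^sup>2 \<le> 0"
      using ab x by (intro divide_nonpos_nonneg mult_nonneg_nonpos) auto
    then show "\<exists>y. DERIV m x :> y \<and> y \<le> 0" using dm[of x] ab x by auto
  qed
  have "z < s0" using up[of 0 s0] m0 zero \<open>0 < s0\<close> by force
  then show "m s \<le> 0" if "s0 \<le> s"
    using down[of s0 s] zero \<open>0 < s0\<close> that by auto
  show "0 \<le> m s" if "0 \<le> s" "s \<le> s0"
    using up[of 0 s] down[of s s0] zero m0 that by (cases "s = 0"; cases "s \<le> z") auto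
qed

text \<open>The optimal exponential tilt from Bernoulli(t0) to Bernoulli(t0 + \<eta>) at the
  stationary point \<open>t0\<close> fixes \<open>c\<close>. The function
  \<open>h t = (t + \<eta>) * ln (1 + c / t)\<close> is then minimal at \<open>t0\<close>, where
  \<open>h t0 - ln (1 + c)\<close> is the relative entropy, so Pinsker's inequality applies.\<close>

lemma boundary_exponent:
  fixes \<eta> :: real
  assumes "0 < \<eta>" "\<eta> < 1"
  obtains c \<kappa> where "0 < c" "2 * \<eta>\<^sup>2 < \<kappa>"
    "\<And>t. 0 < t \<Longrightarrow> ln (1 + c) + \<kappa> \<le> (t + \<eta>) * ln (1 + c / t)"
proof -
  obtain t0 where t0: "0 < t0" "t0 + \<eta> < 1" and
    stat: "ln ((t0 + \<eta>) / t0) + ln ((1 - t0) / (1 - t0 - \<eta>)) = \<eta> / t0 + \<eta> / (1 - t0)"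
    using stationary_point[OF assms] .
  \<comment> \<open>With this \<open>c\<close>, \<open>1 + c / t0\<close> is the odds ratio of the
    parameters \<open>t0 + \<eta>\<close> and \<open>t0\<close>, and
    \<open>1 + c = (1 - t0) + t0 * (1 + c / t0)\<close> is the matching moment generating
    function.\<close>
  define c where "c = \<eta> / (1 - t0 - \<eta>)"
  \<comment> \<open>Writing \<open>\<eta> = \<rho> * c\<close> makes the derivative of
    \<open>h\<close> a function of \<open>c / t\<close> alone.\<close>
  define \<rho> where "\<rho> = 1 - t0 - \<eta>"
  have c: "0 < c" using t0 assms by (simp add: c_def)
  have \<rho>: "0 < \<rho>" "\<eta> = \<rho> * c" using t0 by (auto simp: \<rho>_def c_def)
  define m where "m s = ln (1 + s) - s * (1 + \<rho> * s) / (1 + s)" for s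
  define h where "h t = (t + \<eta>) * ln (1 + c / t)" for t
  have dh: "(h has_real_derivative m (c / t)) (at t)" if "0 < t" for t
  proof -
    have "0 < 1 + c / t" using that c by (simp add: add_pos_pos)
    then have "(h has_real_derivative ln (1 + c / t) + (t + \<eta>) * (- c / t\<^sup>2 / (1 + c / t))) (at t)"
      unfolding h_def using that by (auto intro!: derivative_eq_intros simp: power2_eq_square mult.commute)
    moreover have "(t + \<eta>) * (- c / t\<^sup>2 / (1 + c / t)) = - (c / t * (1 + \<rho> * (c / t)) / (1 + c / t))"
      using that c unfolding \<rho>(2) by (simp add: divide_simps power2_eq_square)
    ultimately show ?thesis by (simp add: m_def)
  qed
  have c1: "1 + c = (1 - t0) / (1 - t0 - \<eta>)"
    using t0 by (simp add: c_def field_simps)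
  have ct: "1 + c / t0 = (t0 + \<eta>) / t0 * ((1 - t0) / (1 - t0 - \<eta>))"
    using t0 by (simp add: c_def divide_simps) (simp add: algebra_simps)
  have lnct: "ln (1 + c / t0) = ln ((t0 + \<eta>) / t0) + ln ((1 - t0) / (1 - t0 - \<eta>))"
    unfolding ct using t0 assms by (intro ln_mult_pos) auto
  \<comment> \<open>This is the stationarity equation \<open>stat\<close> in the variable
    \<open>c / t0\<close>.\<close>
  have "m (c / t0) = 0"
  proof -
    have "c / t0 * (1 + \<rho> * (c / t0)) / (1 + c / t0) = \<eta> / t0 + \<eta> / (1 - t0)"
    proof -
      have "1 + \<rho> * (c / t0) = (t0 + \<eta>) / t0"
        using t0 by (simp add: \<rho>(2) field_simps)
      then have "c / t0 * (1 + \<rho> * (c / t0)) / (1 + c / t0) = c / t0 * ((1 - t0 - \<eta>) / (1 - t0))"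
        unfolding ct using t0 assms by simp
      also have "\<dots> = \<eta> / (t0 * (1 - t0))"
        using t0 by (simp add: c_def)
      also have "\<dots> = \<eta> / t0 + \<eta> / (1 - t0)"
        using t0 assms by (simp add: field_simps)
      finally show ?thesis .
    qed
    then show ?thesis using stat by (simp add: m_def lnct)
  qed
  then have sgn: "c / t0 \<le> s \<Longrightarrow> m s \<le> 0" "0 \<le> s \<Longrightarrow> s \<le> c / t0 \<Longrightarrow> 0 \<le> m s" for s
    using log_rational_sign[of \<rho> "c / t0" s] \<rho>(1) c t0 unfolding m_def by auto
  \<comment> \<open>As \<open>c / t\<close> decreases in \<open>t\<close>, the sign pattern of
    \<open>m\<close> makes \<open>h\<close> nonincreasing up to \<open>t0\<close> and nondecreasing
    afterwards.\<close>
  have min: "h t0 \<le> h t" if "0 < t" for t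
  proof (cases "t \<le> t0")
    case True
    show ?thesis
    proof (rule DERIV_nonpos_imp_nonincreasing[OF True])
      fix x assume "t \<le> x" "x \<le> t0"
      moreover from this have "c / t0 \<le> c / x" using that c by (intro divide_left_mono) auto
      ultimately show "\<exists>y. DERIV h x :> y \<and> y \<le> 0" using dh[of x] sgn(1)[of "c / x"] that by auto
    qed
  next
    case False
    then have "t0 \<le> t" by simp
    then show ?thesis
    proof (rule DERIV_nonneg_imp_nondecreasing)
      fix x assume "t0 \<le> x" "x \<le> t"
      moreover from this have "c / x \<le> c / t0" using t0 c by (intro divide_left_mono) auto
      ultimately show "\<exists>y. DERIV h x :> y \<and> 0 \<le> y" using dh[of x] sgn(2)[of "c / x"] t0 c by auto
    qed
  qed
  define \<kappa> where "\<kappa> = h t0 - ln (1 + c)"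
  have ln_flip: "ln ((1 - t0) / (1 - t0 - \<eta>)) = - ln ((1 - t0 - \<eta>) / (1 - t0))"
    using t0 assms by (simp add: ln_div)
  have "\<kappa> = (t0 + \<eta>) * ln ((t0 + \<eta>) / t0) + (1 - t0 - \<eta>) * ln ((1 - t0 - \<eta>) / (1 - t0))"
    unfolding \<kappa>_def h_def lnct c1 ln_flip by (simp add: algebra_simps)
  then have "2 * \<eta>\<^sup>2 < \<kappa>"
    using binary_pinsker_strict[OF t0(1) assms(1) t0(2)] by simp
  then show ?thesis
    using that[OF c, of \<kappa>] min unfolding \<kappa>_def h_def by auto
qed

section \<open>A maximal inequality for empirical measures\<close>

text \<open>\<open>g\<close> cannot tell points of \<open>S\<close> apart in any coordinate, so
  integrating a coordinate over \<open>S\<close> sees only the mass of the factor there, which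
  \<open>u\<close> and \<open>v\<close> share; off \<open>S\<close> they agree. The factors are
  exchanged one coordinate at a time. This is the conditional expectation in optional stopping,
  without a filtration.\<close>

lemma nn_integral_PiM_swap_factor:
  fixes D :: "'b measure" and u v :: "'b \<Rightarrow> ennreal"
  assumes "prob_space D" "finite I" and S[measurable]: "S \<in> sets D"
    and u[measurable]: "u \<in> borel_measurable D" and v[measurable]: "v \<in> borel_measurable D"
    and out: "\<And>y. y \<in> space D - S \<Longrightarrow> u y = v y"
    and ins: "(\<integral>\<^sup>+y\<in>S. u y \<partial>D) = (\<integral>\<^sup>+y\<in>S. v y \<partial>D)"
    and "g \<in> borel_measurable (PiM I (\<lambda>_. D))"
    and "\<And>x x'. x \<in> space (PiM I (\<lambda>_. D)) \<Longrightarrow> x' \<in> space (PiM I (\<lambda>_. D)) \<Longrightarrow>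
      (\<And>i. i \<in> I \<Longrightarrow> x i = x' i \<or> x i \<in> S \<and> x' i \<in> S) \<Longrightarrow> g x = g x'"
  shows "(\<integral>\<^sup>+x. g x * (\<Prod>i\<in>I. u (x i)) \<partial>PiM I (\<lambda>_. D)) = (\<integral>\<^sup>+x. g x * (\<Prod>i\<in>I. v (x i)) \<partial>PiM I (\<lambda>_. D))"
  using assms(2,8,9)
proof (induction I arbitrary: g rule: finite_induct)
  case empty
  show ?case by simp
next
  case (insert i I)
  interpret D: prob_space D by fact
  interpret product_sigma_finite "\<lambda>_. D" ..
  let ?P = "PiM I (\<lambda>_. D)"
  note [measurable] = insert.prems(1)
  have upd: "x(i := y) \<in> space (PiM (insert i I) (\<lambda>_. D))" if "x \<in> space ?P" "y \<in> space D" for x y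
    using that insert.hyps by (auto simp: space_PiM PiE_def Pi_def extensional_def)
  have split: "(\<integral>\<^sup>+x. g x * (\<Prod>j\<in>insert i I. w (x j)) \<partial>PiM (insert i I) (\<lambda>_. D)) =
      (\<integral>\<^sup>+x. (\<integral>\<^sup>+y. g (x(i := y)) * w y \<partial>D) * (\<Prod>j\<in>I. w (x j)) \<partial>?P)"
    if w[measurable]: "w \<in> borel_measurable D" for w :: "'b \<Rightarrow> ennreal"
  proof -
    have "(\<integral>\<^sup>+x. g x * (\<Prod>j\<in>insert i I. w (x j)) \<partial>PiM (insert i I) (\<lambda>_. D)) =
        (\<integral>\<^sup>+x. (\<integral>\<^sup>+y. g (x(i := y)) * (\<Prod>j\<in>insert i I. w ((x(i := y)) j)) \<partial>D) \<partial>?P)"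
      using insert.hyps by (subst product_nn_integral_insert) auto
    also have "\<dots> = (\<integral>\<^sup>+x. (\<integral>\<^sup>+y. (g (x(i := y)) * w y) * (\<Prod>j\<in>I. w (x j)) \<partial>D) \<partial>?P)"
    proof (intro nn_integral_cong)
      fix x y
      have "(\<Prod>j\<in>insert i I. w ((x(i := y)) j)) = w y * (\<Prod>j\<in>I. w (x j))"
        using insert.hyps by (subst prod.insert) (auto intro!: prod.cong arg_cong2[of _ _ _ _ "(*)"])
      then show "g (x(i := y)) * (\<Prod>j\<in>insert i I. w ((x(i := y)) j)) =
          (g (x(i := y)) * w y) * (\<Prod>j\<in>I. w (x j))"
        by (simp add: mult.assoc)
    qed
    also have "\<dots> = (\<integral>\<^sup>+x. (\<integral>\<^sup>+y. g (x(i := y)) * w y \<partial>D) * (\<Prod>j\<in>I. w (x j)) \<partial>?P)"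
    proof (intro nn_integral_cong nn_integral_multc)
      fix x assume "x \<in> space ?P"
      then have [measurable]: "(\<lambda>y. x(i := y)) \<in> measurable D (PiM (insert i I) (\<lambda>_. D))"
        by (intro measurable_PiM_single') (auto simp: space_PiM PiE_def Pi_def extensional_def)
      show "(\<lambda>y. g (x(i := y)) * w y) \<in> borel_measurable D" by measurable
    qed
    finally show ?thesis .
  qed
  have inner: "(\<integral>\<^sup>+y. g (x(i := y)) * u y \<partial>D) = (\<integral>\<^sup>+y. g (x(i := y)) * v y \<partial>D)"
    if x: "x \<in> space ?P" for x
  proof -
    have [measurable]: "(\<lambda>y. x(i := y)) \<in> measurable D (PiM (insert i I) (\<lambda>_. D))"
      using x by (intro measurable_PiM_single') (auto simp: space_PiM PiE_def Pi_def extensional_def)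
    \<comment> \<open>\<open>k\<close> is the common value of \<open>g\<close> when the new
      coordinate lies in \<open>S\<close>; for empty \<open>S\<close> any value serves.\<close>
    obtain k where k: "g (x(i := y)) = k" if "y \<in> S" for y
    proof (cases "S = {}")
      case False
      then obtain y0 where "y0 \<in> S" by auto
      then have "g (x(i := y)) = g (x(i := y0))" if "y \<in> S" for y
        using that sets.sets_into_space[OF S] x by (intro insert.prems(2) upd) auto
      then show ?thesis using that by blast
    qed (use that in auto)
    have parts: "(\<integral>\<^sup>+y. g (x(i := y)) * w y \<partial>D) =
        k * (\<integral>\<^sup>+y\<in>S. w y \<partial>D) + (\<integral>\<^sup>+y. g (x(i := y)) * (w y * indicator (space D - S) y) \<partial>D)"
      if [measurable]: "w \<in> borel_measurable D" for w :: "'b \<Rightarrow> ennreal"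
    proof -
      have "(\<integral>\<^sup>+y. g (x(i := y)) * w y \<partial>D) = (\<integral>\<^sup>+y. k * (w y * indicator S y) +
          g (x(i := y)) * (w y * indicator (space D - S) y) \<partial>D)"
        by (intro nn_integral_cong) (auto simp: k split: split_indicator)
      also have "\<dots> = (\<integral>\<^sup>+y. k * (w y * indicator S y) \<partial>D) +
          (\<integral>\<^sup>+y. g (x(i := y)) * (w y * indicator (space D - S) y) \<partial>D)"
        by (intro nn_integral_add) measurable
      finally show ?thesis by (simp add: nn_integral_cmult)
    qed
    have "(\<integral>\<^sup>+y. g (x(i := y)) * (u y * indicator (space D - S) y) \<partial>D) =
        (\<integral>\<^sup>+y. g (x(i := y)) * (v y * indicator (space D - S) y) \<partial>D)"
      by (intro nn_integral_cong) (auto simp: out split: split_indicator)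
    then show ?thesis
      unfolding parts[OF u] parts[OF v] ins by simp
  qed
  \<comment> \<open>\<open>G\<close> already carries the factor \<open>v\<close> in the coordinate
    \<open>i\<close>. It inherits the insensitivity inside \<open>S\<close>, so the induction
    hypothesis applies to it.\<close>
  define G where "G x = (\<integral>\<^sup>+y. g (x(i := y)) * v y \<partial>D)" for x
  have "(\<lambda>(x, y). g (x(i := y)) * v y) \<in> borel_measurable (?P \<Otimes>\<^sub>M D)"
    using insert.hyps by measurable
  then have G: "G \<in> borel_measurable ?P"
    unfolding G_def by (rule D.borel_measurable_nn_integral)
  have "(\<integral>\<^sup>+x. g x * (\<Prod>j\<in>insert i I. u (x j)) \<partial>PiM (insert i I) (\<lambda>_. D)) =
      (\<integral>\<^sup>+x. G x * (\<Prod>j\<in>I. u (x j)) \<partial>?P)"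
    unfolding split[OF u] G_def by (intro nn_integral_cong) (simp add: inner)
  also have "\<dots> = (\<integral>\<^sup>+x. G x * (\<Prod>j\<in>I. v (x j)) \<partial>?P)"
  proof (rule insert.IH[OF G])
    fix x x' assume x: "x \<in> space ?P" "x' \<in> space ?P" "\<And>j. j \<in> I \<Longrightarrow> x j = x' j \<or> x j \<in> S \<and> x' j \<in> S"
    then show "G x = G x'"
      unfolding G_def
      by (intro nn_integral_cong arg_cong2[of _ _ _ _ "(*)"] insert.prems(2) upd refl) auto
  qed
  also have "\<dots> = (\<integral>\<^sup>+x. g x * (\<Prod>j\<in>insert i I. v (x j)) \<partial>PiM (insert i I) (\<lambda>_. D))"
    unfolding split[OF v] G_def ..
  finally show ?case .
qed

text \<open>Doob's maximal inequality for a martingale indexed by the chain, run from large sets to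
  small ones. The crossing event is split by the largest crossed set \<open>S\<close>. There the
  product of the factors \<open>u S\<close> is at least
  \<open>(1 + c) ^ n * exp (n * \<kappa>)\<close> with n = \<open>card I\<close>, while the product
  for the smallest set has mean \<open>(1 + c) ^ n\<close>.\<close>

lemma chain_crossing_bound:
  fixes D :: "'b measure" and I :: "'i set" and \<S> :: "'b set set" and c \<eta> \<kappa> :: real
  defines "P \<equiv> PiM I (\<lambda>_. D)"
  defines "C \<equiv> \<lambda>S x. real (card I) * (measure D S + \<eta>) < real (card {i\<in>I. x i \<in> S})"
  assumes "prob_space D" "finite I" "finite \<S>" "\<S> \<subseteq> sets D"
    and chain: "\<And>S T. S \<in> \<S> \<Longrightarrow> T \<in> \<S> \<Longrightarrow> S \<subseteq> T \<or> T \<subseteq> S"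
    and pos: "\<And>S. S \<in> \<S> \<Longrightarrow> 0 < measure D S"
    and c: "0 < c"
    and \<kappa>: "\<And>t. 0 < t \<Longrightarrow> ln (1 + c) + \<kappa> \<le> (t + \<eta>) * ln (1 + c / t)"
  shows "measure P {x \<in> space P. \<exists>S\<in>\<S>. C S x} \<le> exp (- real (card I) * \<kappa>)"
proof (cases "\<S> = {}")
  case False
  let ?n = "card I"
  interpret D: prob_space D by fact
  interpret product_sigma_finite "\<lambda>_. D" ..
  interpret P: prob_space P unfolding P_def by (intro prob_space_PiM assms(3))
  have [measurable]: "S \<in> sets D" if "S \<in> \<S>" for S using that assms by auto
  have card_sum: "real (card {i\<in>I. x i \<in> S}) = (\<Sum>i\<in>I. indicator S (x i))" for x S
    using \<open>finite I\<close> by (simp add: indicator_def sum.If_cases Int_def)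
  have C_meas[measurable]: "Measurable.pred P (C S)" if [measurable]: "S \<in> \<S>" for S
    unfolding C_def P_def card_sum using that by measurable
  \<comment> \<open>On \<open>A S\<close> the downward run crosses for the first time at
    \<open>S\<close>.\<close>
  define A where "A S = {x \<in> space P. C S x \<and> (\<forall>T\<in>\<S>. S \<subset> T \<longrightarrow> \<not> C T x)}" for S
  have A[measurable]: "A S \<in> sets P" if "S \<in> \<S>" for S
    unfolding A_def using that \<open>finite \<S>\<close> by measurable
  \<comment> \<open>\<open>S0\<close> is the last time of the martingale; every stopped value is
    compared with its factor.\<close>
  obtain S0 where S0: "S0 \<in> \<S>" and min: "\<And>S. S \<in> \<S> \<Longrightarrow> S \<subseteq> S0 \<Longrightarrow> S0 = S"
    using finite_has_minimal[OF \<open>finite \<S>\<close> False] by blast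
  have S0_le: "S0 \<subseteq> S" if "S \<in> \<S>" for S
    using chain[OF S0 that] min[OF that] by blast
  note S0 = S0 S0_le
  \<comment> \<open>The product of \<open>u S\<close> over the sample is
    \<open>1 + c / measure D S\<close> to the power of the number of hits in \<open>S\<close>: the
    martingale at time \<open>S\<close>.\<close>
  define u where "u S y = 1 + ennreal (c / measure D S) * indicator S y" for S y
  have u[measurable]: "u S \<in> borel_measurable D" if "S \<in> \<S>" for S
    unfolding u_def using that by measurable
  \<comment> \<open>The mass over \<open>T\<close> does not depend on \<open>S\<close>. Hence
    \<open>u S0\<close> and \<open>u S\<close> have the same mass over \<open>S\<close>, as the swap
    of factors requires.\<close>
  have uS: "(\<integral>\<^sup>+y\<in>T. u S y \<partial>D) = ennreal (measure D T + c)" if "S \<in> \<S>" "T \<in> \<S>" "S \<subseteq> T" for S T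
  proof -
    note [measurable] = that(1,2)
    have "(\<integral>\<^sup>+y\<in>T. u S y \<partial>D) = (\<integral>\<^sup>+y. indicator T y + ennreal (c / measure D S) * indicator S y \<partial>D)"
      using that by (intro nn_integral_cong) (auto simp: u_def split: split_indicator)
    also have "\<dots> = emeasure D T + ennreal (c / measure D S) * emeasure D S"
      using that by (subst nn_integral_add) (auto simp: nn_integral_cmult)
    also have "\<dots> = ennreal (measure D T + c)"
      using pos[of S] that c
      by (simp add: D.emeasure_eq_measure ennreal_mult[symmetric] ennreal_plus[symmetric] del: ennreal_plus)
    finally show ?thesis .
  qed
  have total: "(\<integral>\<^sup>+x. (\<Prod>i\<in>I. u S0 (x i)) \<partial>P) = ennreal ((1 + c) ^ ?n)"
  proof -
    have "(\<integral>\<^sup>+y. u S0 y \<partial>D) = 1 + ennreal (c / measure D S0) * emeasure D S0"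
      unfolding u_def using S0 by (subst nn_integral_add) (auto simp: nn_integral_cmult D.emeasure_space_1)
    also have "\<dots> = ennreal (1 + c)"
      using pos[of S0] S0 c by (simp add: D.emeasure_eq_measure ennreal_mult[symmetric])
    finally have u0: "(\<integral>\<^sup>+y. u S0 y \<partial>D) = ennreal (1 + c)" .
    show ?thesis
      unfolding P_def using S0 c \<open>finite I\<close> by (subst product_nn_integral_prod) (auto simp: u0 ennreal_power simp del: ennreal_plus)
  qed
  \<comment> \<open>Optional stopping: \<open>A S\<close> is decided by the points outside \<open>S\<close>, and the factors for \<open>S0\<close> and \<open>S\<close> agree there.\<close>
  have stop: "(\<integral>\<^sup>+x. indicator (A S) x * (\<Prod>i\<in>I. u S0 (x i)) \<partial>P) =
      (\<integral>\<^sup>+x. indicator (A S) x * (\<Prod>i\<in>I. u S (x i)) \<partial>P)" if S: "S \<in> \<S>" for S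
    unfolding P_def
  proof (rule nn_integral_PiM_swap_factor[where S = S])
    show "indicator (A S) \<in> borel_measurable (PiM I (\<lambda>_. D))"
      using A[OF S] unfolding P_def by measurable
    show "u S0 y = u S y" if "y \<in> space D - S" for y
      using that S0_le[OF S] by (auto simp: u_def indicator_def)
    show "(\<integral>\<^sup>+y\<in>S. u S0 y \<partial>D) = (\<integral>\<^sup>+y\<in>S. u S y \<partial>D)"
      by (simp add: uS[OF S0(1) S S0_le[OF S]] uS[OF S S order_refl])
    fix x x' assume x: "x \<in> space (PiM I (\<lambda>_. D))" "x' \<in> space (PiM I (\<lambda>_. D))"
      and eq: "\<And>i. i \<in> I \<Longrightarrow> x i = x' i \<or> x i \<in> S \<and> x' i \<in> S"
    have "C T x = C T x'" if "S \<subseteq> T" for T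
    proof -
      have "{i\<in>I. x i \<in> T} = {i\<in>I. x' i \<in> T}" using eq that by fastforce
      then show ?thesis by (simp add: C_def)
    qed
    then have "x \<in> A S \<longleftrightarrow> x' \<in> A S"
      using x unfolding A_def P_def by (auto simp: psubset_eq)
    then show "indicator (A S) x = (indicator (A S) x' :: ennreal)"
      by (simp add: indicator_def)
  qed (use S S0 \<open>finite I\<close> assms(3) in auto)
  define K where "K = (1 + c) ^ ?n * exp (real ?n * \<kappa>)"
  have K: "K > 0" using c by (simp add: K_def)
  have below: "ennreal K * emeasure P (A S) \<le> (\<integral>\<^sup>+x. indicator (A S) x * (\<Prod>i\<in>I. u S (x i)) \<partial>P)"
    if S: "S \<in> \<S>" for S
  proof -
    let ?t = "measure D S"
    have "ennreal K \<le> (\<Prod>i\<in>I. u S (x i))" if x: "x \<in> A S" for x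
    proof -
      have t: "0 < ?t" using pos S by auto
      let ?k = "card {i\<in>I. x i \<in> S}"
      have "(\<Prod>i\<in>I. u S (x i)) = (\<Prod>i\<in>I. if x i \<in> S then ennreal (1 + c / ?t) else 1)"
        using c t by (intro prod.cong) (auto simp: u_def)
      also have "\<dots> = ennreal ((1 + c / ?t) ^ ?k)"
        using \<open>finite I\<close> c t by (simp add: prod.If_cases Int_def ennreal_power del: ennreal_plus)
      finally have eq: "(\<Prod>i\<in>I. u S (x i)) = ennreal ((1 + c / ?t) ^ ?k)" .
      have "0 < 1 + c / ?t" using c t by (simp add: add_pos_pos)
      \<comment> \<open>In logarithms, the hypothesis on \<kappa> at \<open>t = measure D S\<close>
        meets the crossing condition, which bounds the number of hits below by
        \<open>card I * (t + \<eta>)\<close>.\<close>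
      have "ln K = real ?n * (ln (1 + c) + \<kappa>)"
        using c by (simp add: K_def ln_mult ln_realpow algebra_simps)
      also have "\<dots> \<le> real ?n * ((?t + \<eta>) * ln (1 + c / ?t))"
        using \<kappa>[OF t] by (intro mult_left_mono) auto
      also have "\<dots> \<le> real ?k * ln (1 + c / ?t)"
        using x c t unfolding A_def C_def mult.assoc[symmetric] by (intro mult_right_mono) auto
      also have "\<dots> = ln ((1 + c / ?t) ^ ?k)"
        using \<open>0 < 1 + c / ?t\<close> by (simp add: ln_realpow)
      finally have "K \<le> (1 + c / ?t) ^ ?k"
        using K \<open>0 < 1 + c / ?t\<close> by (subst (asm) ln_le_cancel_iff) auto
      then show ?thesis unfolding eq by (rule ennreal_leI)
    qed
    then have "(\<integral>\<^sup>+x. ennreal K * indicator (A S) x \<partial>P) \<le> (\<integral>\<^sup>+x. indicator (A S) x * (\<Prod>i\<in>I. u S (x i)) \<partial>P)"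
      by (intro nn_integral_mono) (auto split: split_indicator)
    then show ?thesis using A[OF S] by (simp add: nn_integral_cmult)
  qed
  have disj: "disjoint_family_on A \<S>"
    unfolding disjoint_family_on_def
  proof (intro ballI impI equals0I)
    fix S T x assume ST: "S \<in> \<S>" "T \<in> \<S>" "S \<noteq> T" and x: "x \<in> A S \<inter> A T"
    have "S \<subset> T \<or> T \<subset> S" using chain[OF ST(1,2)] ST(3) by auto
    then show False using x ST(1,2) by (auto simp: A_def)
  qed
  have bad: "{x \<in> space P. \<exists>S\<in>\<S>. C S x} = (\<Union>S\<in>\<S>. A S)"
  proof (intro equalityI subsetI)
    fix x assume "x \<in> {x \<in> space P. \<exists>S\<in>\<S>. C S x}"
    then have x: "x \<in> space P" "{S\<in>\<S>. C S x} \<noteq> {}" by auto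
    then obtain S where "S \<in> {S\<in>\<S>. C S x}" "\<forall>T\<in>{S\<in>\<S>. C S x}. S \<subseteq> T \<longrightarrow> S = T"
      using finite_has_maximal[of "{S\<in>\<S>. C S x}"] \<open>finite \<S>\<close> by auto
    then show "x \<in> (\<Union>S\<in>\<S>. A S)" using x(1) by (auto simp: A_def)
  qed (auto simp: A_def)
  \<comment> \<open>Markov's inequality on each \<open>A S\<close>, moved to the common factor
    \<open>u S0\<close> by \<open>stop\<close>; the \<open>A S\<close> are disjoint, so the pieces
    add up to at most the total integral.\<close>
  have "ennreal K * emeasure P (\<Union>S\<in>\<S>. A S) = (\<Sum>S\<in>\<S>. ennreal K * emeasure P (A S))"
    using disj \<open>finite \<S>\<close> by (subst sum_emeasure[symmetric]) (auto simp: sum_distrib_left)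
  also have "\<dots> \<le> (\<Sum>S\<in>\<S>. \<integral>\<^sup>+x. indicator (A S) x * (\<Prod>i\<in>I. u S0 (x i)) \<partial>P)"
    by (intro sum_mono) (simp add: stop below)
  also have "\<dots> = (\<integral>\<^sup>+x. (\<Sum>S\<in>\<S>. indicator (A S) x * (\<Prod>i\<in>I. u S0 (x i))) \<partial>P)"
    using S0(1) A by (intro nn_integral_sum[symmetric]) (auto simp: P_def)
  also have "\<dots> \<le> (\<integral>\<^sup>+x. (\<Prod>i\<in>I. u S0 (x i)) \<partial>P)"
  proof (intro nn_integral_mono)
    fix x
    have "(\<Sum>S\<in>\<S>. indicator (A S) x :: ennreal) = indicator (\<Union>S\<in>\<S>. A S) x"
      using disj \<open>finite \<S>\<close> by (rule indicator_UN_disjoint[symmetric, rotated])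
    then show "(\<Sum>S\<in>\<S>. indicator (A S) x * (\<Prod>i\<in>I. u S0 (x i))) \<le> (\<Prod>i\<in>I. u S0 (x i))"
      by (simp add: sum_distrib_right[symmetric] indicator_def)
  qed
  finally have "ennreal (K * measure P (\<Union>S\<in>\<S>. A S)) \<le> ennreal ((1 + c) ^ ?n)"
    unfolding total using K by (simp add: P.emeasure_eq_measure ennreal_mult)
  then have "K * measure P (\<Union>S\<in>\<S>. A S) \<le> (1 + c) ^ ?n"
    using c by (subst (asm) ennreal_le_iff) auto
  then have "exp (real ?n * \<kappa>) * measure P (\<Union>S\<in>\<S>. A S) \<le> 1"
    using c by (simp add: K_def mult.assoc)
  then show ?thesis
    unfolding bad by (simp add: exp_minus field_simps)
qed simp

section \<open>Empirical CDFs at rational and real thresholds\<close>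

lemma emp_cdf_eq_card: "emp_cdf n y t = real (card {i\<in>{1..n}. y i \<le> t}) / real n"
  unfolding emp_cdf_def by (simp add: indicator_def sum.If_cases Int_def)

lemma emp_cdf_right_cont:
  assumes "1 \<le> n"
  shows "(emp_cdf n y \<longlongrightarrow> emp_cdf n y t) (at_right t)"
proof (rule tendsto_eventually)
  have "eventually (\<lambda>s. \<forall>i\<in>{1..n}. y i \<le> s \<longleftrightarrow> y i \<le> t) (at_right t)"
  proof (intro eventually_ball_finite ballI)
    fix i
    show "eventually (\<lambda>s. y i \<le> s \<longleftrightarrow> y i \<le> t) (at_right t)"
    proof (cases "y i \<le> t")
      case True
      then show ?thesis
        by (intro eventually_mono[OF eventually_at_right_less[of t]]) auto
    next
      case False
      then have "eventually (\<lambda>s. s \<in> {t<..<y i}) (at_right t)"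
        by (intro eventually_at_right_real) auto
      then show ?thesis by (rule eventually_mono) (use False in auto)
    qed
  qed simp
  then show "eventually (\<lambda>s. emp_cdf n y s = emp_cdf n y t) (at_right t)"
  proof eventually_elim
    case (elim s)
    then have "{i\<in>{1..n}. y i \<le> s} = {i\<in>{1..n}. y i \<le> t}" by blast
    then show ?case by (simp add: emp_cdf_eq_card)
  qed
qed

text \<open>A violation at \<open>t\<close> would persist on an interval to its right, which
  contains a rational. This extends bounds from countably many thresholds to all.\<close>

lemma le_of_Rats_right_cont:
  fixes f :: "real \<Rightarrow> real"
  assumes "\<And>q. q \<in> \<rat> \<Longrightarrow> f q \<le> c" and "(f \<longlongrightarrow> f t) (at_right t)"
  shows "f t \<le> c"
proof (rule ccontr)
  assume "\<not> f t \<le> c"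
  then have "eventually (\<lambda>s. c < f s) (at_right t)"
    using order_tendstoD(1)[OF assms(2), of c] by simp
  then obtain b where "t < b" "\<And>s. t < s \<Longrightarrow> s < b \<Longrightarrow> c < f s"
    by (auto simp: eventually_at_right_field)
  moreover obtain q where "q \<in> \<rat>" "t < q" "q < b"
    using Rats_dense_in_real[OF \<open>t < b\<close>] by auto
  ultimately show False using assms(1)[of q] by force
qed

text \<open>\<open>D\<close> is at once the common law and the target measurable space, so the joint
  law of the sample is the product measure of \<open>chain_crossing_bound\<close>.\<close>

locale iid_sample = prob_space M for M :: "'c measure" +
  fixes D :: "'b measure" and Ys :: "'i \<Rightarrow> 'c \<Rightarrow> 'b" and I :: "'i set"
  assumes finite_I: "finite I" and I_ne: "I \<noteq> {}"
    and indep: "indep_vars (\<lambda>_. D) Ys I"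
    and distr_eq: "\<And>i. i \<in> I \<Longrightarrow> distr M D (Ys i) = D"
begin

lemma Ys_measurable: "i \<in> I \<Longrightarrow> Ys i \<in> measurable M D"
  using indep unfolding indep_vars_def by blast

lemma prob_space_D: "prob_space D"
proof -
  obtain i where "i \<in> I" using I_ne by auto
  then have "prob_space (distr M D (Ys i))" by (intro prob_space_distr Ys_measurable)
  then show ?thesis using distr_eq[OF \<open>i \<in> I\<close>] by simp
qed

lemma distr_sample: "distr M (PiM I (\<lambda>_. D)) (\<lambda>\<omega>. \<lambda>i\<in>I. Ys i \<omega>) = PiM I (\<lambda>_. D)"
proof -
  have "distr M (PiM I (\<lambda>_. D)) (\<lambda>\<omega>. \<lambda>i\<in>I. Ys i \<omega>) = PiM I (\<lambda>i. distr M D (Ys i))"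
    using indep_vars_iff_distr_eq_PiM'[of I Ys "\<lambda>_. D"] I_ne Ys_measurable indep by blast
  also have "\<dots> = PiM I (\<lambda>_. D)"
    by (intro PiM_cong) (auto simp: distr_eq)
  finally show ?thesis .
qed

lemma card_hits_eq_sum: "real (card {i\<in>I. x i \<in> S}) = (\<Sum>i\<in>I. indicator S (x i))"
  using finite_I by (simp add: indicator_def sum.If_cases Int_def)

lemma sets_crossing:
  assumes "countable \<S>" "\<S> \<subseteq> sets D"
  shows "{\<omega> \<in> space M. \<exists>S\<in>\<S>. f S < real (card {i\<in>I. Ys i \<omega> \<in> S})} \<in> events"
proof -
  have "{\<omega> \<in> space M. f S < real (card {i\<in>I. Ys i \<omega> \<in> S})} \<in> events" if "S \<in> \<S>" for S
  proof -
    note [measurable] = Ys_measurable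
    have [measurable]: "S \<in> sets D" using that assms by auto
    show ?thesis unfolding card_hits_eq_sum by measurable
  qed
  then have "(\<Union>S\<in>\<S>. {\<omega> \<in> space M. f S < real (card {i\<in>I. Ys i \<omega> \<in> S})}) \<in> events"
    using assms by (intro sets.countable_UN') auto
  moreover have "{\<omega> \<in> space M. \<exists>S\<in>\<S>. f S < real (card {i\<in>I. Ys i \<omega> \<in> S})} =
      (\<Union>S\<in>\<S>. {\<omega> \<in> space M. f S < real (card {i\<in>I. Ys i \<omega> \<in> S})})" by blast
  ultimately show ?thesis by simp
qed

text \<open>
  The one-sided Dvoretzky--Kiefer--Wolfowitz inequality with Massart's constant. Chains of sets in
  place of half-lines let the same bound serve both tails.
\<close>

lemma dkw_chain:
  fixes \<S> :: "'b set set"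
  assumes \<eta>: "0 < \<eta>" and \<S>: "countable \<S>" "\<S> \<subseteq> sets D"
    and chain: "\<And>S T. S \<in> \<S> \<Longrightarrow> T \<in> \<S> \<Longrightarrow> S \<subseteq> T \<or> T \<subseteq> S"
  shows "prob {\<omega> \<in> space M. \<exists>S\<in>\<S>. real (card I) * (measure D S + \<eta>) < real (card {i\<in>I. Ys i \<omega> \<in> S})}
    < exp (- 2 * real (card I) * \<eta>\<^sup>2)" (is "prob (?bad \<S>) < _")
proof (cases "\<eta> < 1")
  case False
  \<comment> \<open>For \<eta> at least 1 the threshold is at least \<open>card I\<close>, so no set
    is ever crossed, while the right side is positive.\<close>
  have "\<not> real (card I) * (measure D S + \<eta>) < real (card {i\<in>I. Ys i \<omega> \<in> S})" for S \<omega>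
  proof -
    have "real (card {i\<in>I. Ys i \<omega> \<in> S}) \<le> real (card I) * 1"
      using finite_I by (auto intro!: card_mono)
    also have "\<dots> \<le> real (card I) * (measure D S + \<eta>)"
      using False by (intro mult_left_mono) (auto intro: add_increasing)
    finally show ?thesis by simp
  qed
  then have empty: "?bad \<S> = {}" by blast
  show ?thesis unfolding empty by simp
next
  case True
  interpret D: prob_space D by (rule prob_space_D)
  obtain c \<kappa> where c: "0 < c" and \<kappa>: "2 * \<eta>\<^sup>2 < \<kappa>"
    and bd: "\<And>t. 0 < t \<Longrightarrow> ln (1 + c) + \<kappa> \<le> (t + \<eta>) * ln (1 + c / t)"
    using boundary_exponent[OF \<eta> True] by blast
  let ?C = "\<lambda>S x. real (card I) * (measure D S + \<eta>) < real (card {i\<in>I. x i \<in> S})"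
  have meas: "?bad \<T> \<in> events" if "\<T> \<subseteq> \<S>" for \<T>
    using that \<S> countable_subset[OF that] by (intro sets_crossing) auto
  \<comment> \<open>The event is pulled back from the product space. Positive measure is a condition
    here because the martingale factors divide by \<open>measure D S\<close>.\<close>
  have fin: "prob (?bad \<T>) \<le> exp (- real (card I) * \<kappa>)"
    if \<T>: "finite \<T>" "\<T> \<subseteq> \<S>" "\<And>S. S \<in> \<T> \<Longrightarrow> 0 < measure D S" for \<T>
  proof -
    let ?P = "PiM I (\<lambda>_. D)"
    have "{x \<in> space ?P. ?C S x} \<in> sets ?P" if "S \<in> \<T>" for S
    proof -
      have [measurable]: "S \<in> sets D" using that \<T> \<S> by auto
      show ?thesis unfolding card_hits_eq_sum by measurable
    qed
    then have "(\<Union>S\<in>\<T>. {x \<in> space ?P. ?C S x}) \<in> sets ?P"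
      using \<T>(1) by (intro sets.finite_UN) auto
    also have "(\<Union>S\<in>\<T>. {x \<in> space ?P. ?C S x}) = {x \<in> space ?P. \<exists>S\<in>\<T>. ?C S x}" by blast
    finally have [measurable]: "{x \<in> space ?P. \<exists>S\<in>\<T>. ?C S x} \<in> sets ?P" .
    have [measurable]: "(\<lambda>\<omega>. \<lambda>i\<in>I. Ys i \<omega>) \<in> measurable M ?P"
      by (intro measurable_restrict Ys_measurable)
    have "{i\<in>I. (\<lambda>i\<in>I. Ys i \<omega>) i \<in> S} = {i\<in>I. Ys i \<omega> \<in> S}" for S \<omega> by auto
    then have C_eq: "?C S (\<lambda>i\<in>I. Ys i \<omega>) \<longleftrightarrow> ?C S (\<lambda>i. Ys i \<omega>)" for S \<omega> by (simp only:)
    have sp: "(\<lambda>i\<in>I. Ys i \<omega>) \<in> space ?P" if "\<omega> \<in> space M" for \<omega>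
      using that by (rule measurable_space[rotated]) measurable
    have "?bad \<T> = (\<lambda>\<omega>. \<lambda>i\<in>I. Ys i \<omega>) -` {x \<in> space ?P. \<exists>S\<in>\<T>. ?C S x} \<inter> space M"
    proof (rule set_eqI)
      fix \<omega>
      show "\<omega> \<in> ?bad \<T> \<longleftrightarrow> \<omega> \<in> (\<lambda>\<omega>. \<lambda>i\<in>I. Ys i \<omega>) -` {x \<in> space ?P. \<exists>S\<in>\<T>. ?C S x} \<inter> space M"
        unfolding mem_Collect_eq Int_iff vimage_eq C_eq using sp[of \<omega>] by blast
    qed
    moreover have "measure (distr M ?P (\<lambda>\<omega>. \<lambda>i\<in>I. Ys i \<omega>)) {x \<in> space ?P. \<exists>S\<in>\<T>. ?C S x} =
        prob ((\<lambda>\<omega>. \<lambda>i\<in>I. Ys i \<omega>) -` {x \<in> space ?P. \<exists>S\<in>\<T>. ?C S x} \<inter> space M)"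
      by (intro measure_distr) measurable
    ultimately have "prob (?bad \<T>) = measure (distr M ?P (\<lambda>\<omega>. \<lambda>i\<in>I. Ys i \<omega>)) {x \<in> space ?P. \<exists>S\<in>\<T>. ?C S x}"
      by (simp only:)
    also have "\<dots> = measure ?P {x \<in> space ?P. \<exists>S\<in>\<T>. ?C S x}"
      by (simp add: distr_sample)
    also have "\<dots> \<le> exp (- real (card I) * \<kappa>)"
    proof (rule chain_crossing_bound[OF prob_space_D finite_I \<T>(1) _ _ \<T>(3) c bd])
      show "\<T> \<subseteq> sets D" using \<T> \<S> by auto
      show "S \<subseteq> T \<or> T \<subseteq> S" if "S \<in> \<T>" "T \<in> \<T>" for S T
        using that \<T>(2) chain by blast
    qed
    finally show ?thesis .
  qed
  define \<T> where "\<T> = {S\<in>\<S>. 0 < measure D S}"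
  \<comment> \<open>Finite initial parts of an enumeration exhaust \<open>\<T>\<close>, and
    continuity from below carries the uniform bound over.\<close>
  have count: "prob (?bad \<T>) \<le> exp (- real (card I) * \<kappa>)"
  proof (cases "\<T> = {}")
    case False
    have "countable \<T>" using \<S> by (auto simp: \<T>_def)
    define F where "F k = from_nat_into \<T> ` {..k}" for k :: nat
    have F: "F k \<subseteq> \<T>" "finite (F k)" for k
      using from_nat_into[OF False] by (auto simp: F_def)
    have "(\<Union>k. F k) = \<T>"
    proof -
      have "(\<Union>k. F k) = range (from_nat_into \<T>)" by (auto simp: F_def)
      then show ?thesis using range_from_nat_into[OF False \<open>countable \<T>\<close>] by simp
    qed
    then have un: "?bad \<T> = (\<Union>k. ?bad (F k))" by blast
    have "incseq (\<lambda>k. ?bad (F k))"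
      by (intro incseq_SucI) (auto simp: F_def)
    moreover have "range (\<lambda>k. ?bad (F k)) \<subseteq> events"
      using F by (intro image_subsetI meas) (auto simp: \<T>_def)
    ultimately have "(\<lambda>k. prob (?bad (F k))) \<longlonglongrightarrow> prob (?bad \<T>)"
      unfolding un by (intro finite_Lim_measure_incseq)
    then show ?thesis
      by (rule LIMSEQ_le_const2) (intro exI[of _ 0] allI impI fin, use F in \<open>auto simp: \<T>_def\<close>)
  qed simp
  \<comment> \<open>Almost surely no point hits any of the countably many null sets, and a set
    without hits is not crossed since \<eta> > 0.\<close>
  have "AE \<omega> in M. \<forall>S\<in>{S\<in>\<S>. measure D S = 0}. \<forall>i\<in>I. Ys i \<omega> \<notin> S"
  proof (subst AE_ball_countable)
    show "\<forall>S\<in>{S\<in>\<S>. measure D S = 0}. AE \<omega> in M. \<forall>i\<in>I. Ys i \<omega> \<notin> S"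
    proof (intro ballI AE_finite_allI finite_I)
      fix S i assume S: "S \<in> {S\<in>\<S>. measure D S = 0}" and i: "i \<in> I"
      then have "S \<in> sets D" using \<S> by auto
      then have "S \<in> null_sets D" using S by (auto simp: null_sets_def D.emeasure_eq_measure)
      then have "AE y in distr M D (Ys i). y \<notin> S"
        unfolding distr_eq[OF i] by (rule AE_not_in)
      then show "AE \<omega> in M. Ys i \<omega> \<notin> S"
        using \<open>S \<in> sets D\<close> i by (subst (asm) AE_distr_iff) (auto intro: Ys_measurable)
    qed
  qed (use \<S> in auto)
  then have "prob (?bad \<S>) \<le> prob (?bad \<T>)"
  proof (intro finite_measure_mono_AE meas, eventually_elim)
    case (elim \<omega>)
    have "0 < measure D S" if S: "S \<in> \<S>" and cr: "?C S (\<lambda>i. Ys i \<omega>)" for S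
    proof (rule ccontr)
      assume "\<not> 0 < measure D S"
      then have "measure D S = 0" using measure_nonneg[of D S] by simp
      then have no_hit: "{i\<in>I. Ys i \<omega> \<in> S} = {}" using elim S by auto
      show False
        using cr \<eta> \<open>measure D S = 0\<close> unfolding no_hit by (simp add: mult_less_0_iff)
    qed
    then show ?case by (auto simp: \<T>_def)
  qed (auto simp: \<T>_def)
  also note count
  \<comment> \<open>The limit preserves only a weak inequality;
    \<open>2 * \<eta>\<^sup>2 < \<kappa>\<close> makes it strict.\<close>
  also have "exp (- real (card I) * \<kappa>) < exp (- 2 * real (card I) * \<eta>\<^sup>2)"
    using \<kappa> finite_I I_ne by (simp add: card_gt_0_iff)
  finally show ?thesis .
qed

end

text \<open>The half-lines \<open>{..q}\<close> give the upper deviation and their complements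
  \<open>{q<..}\<close> the lower one, with \<open>q\<close> rational so that the chain is
  countable. On the resulting measurable set \<open>G\<close>, right-continuity extends the bound to
  all real \<open>t\<close>.\<close>

lemma iid_dkw_good_event:
  fixes D :: "real measure" and Ys :: "nat \<Rightarrow> 'c \<Rightarrow> real"
  assumes "prob_space M" and indep: "prob_space.indep_vars M (\<lambda>_. borel) Ys {1..n}"
    and distr: "\<And>i. i \<in> {1..n} \<Longrightarrow> distr M borel (Ys i) = D" and n: "1 \<le> n" and \<eta>: "0 < \<eta>"
  shows "\<exists>G\<in>sets M. 1 - exp (- 2 * real n * \<eta>\<^sup>2) < measure M G \<and>
      (\<forall>\<omega>\<in>G. \<forall>t. emp_cdf n (\<lambda>i. Ys i \<omega>) t - cdf D t \<le> \<eta>)" (is ?upper)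
    and "\<exists>G\<in>sets M. 1 - exp (- 2 * real n * \<eta>\<^sup>2) < measure M G \<and>
      (\<forall>\<omega>\<in>G. \<forall>t. cdf D t - emp_cdf n (\<lambda>i. Ys i \<omega>) t \<le> \<eta>)" (is ?lower)
proof -
  interpret prob_space M by fact
  have "distr M borel (Ys 1) = D" using distr n by auto
  then have sets_D: "sets D = sets borel" by (metis sets_distr)
  then have space_D: "space D = UNIV" by (metis sets_eq_imp_space_eq space_borel)
  interpret iid_sample M D Ys "{1..n}"
  proof
    show "indep_vars (\<lambda>_. D) Ys {1..n}"
      using indep sets_D unfolding indep_vars_def by (simp cong: measurable_cong_sets)
    show "distr M D (Ys i) = D" if "i \<in> {1..n}" for i
      using distr[OF that] sets_D by (metis distr_cong)
  qed (use n in auto)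
  interpret D: prob_space D by (rule prob_space_D)
  interpret D: real_distribution D by standard (simp add: sets_D)
  have good: "\<exists>G\<in>sets M. 1 - exp (- 2 * real n * \<eta>\<^sup>2) < measure M G \<and>
      (\<forall>\<omega>\<in>G. \<forall>q\<in>\<rat>. real (card {i\<in>{1..n}. Ys i \<omega> \<in> S q}) \<le> real n * (measure D (S q) + \<eta>))"
    if S: "mono S \<or> antimono S" "\<And>q. S q \<in> sets borel" for S :: "real \<Rightarrow> real set"
  proof -
    define B where "B = {\<omega> \<in> space M. \<exists>T\<in>S ` \<rat>. real (card {1..n}) * (measure D T + \<eta>) <
      real (card {i\<in>{1..n}. Ys i \<omega> \<in> T})}"
    have comp: "S p \<subseteq> S q \<or> S q \<subseteq> S p" for p q
      using S(1) linear[of p q] by (auto simp: monotone_def)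
    have "prob B < exp (- 2 * real (card {1..n}) * \<eta>\<^sup>2)"
      unfolding B_def
    proof (rule dkw_chain[OF \<eta>])
      show "countable (S ` \<rat>)" by (intro countable_image countable_rat)
      show "S ` \<rat> \<subseteq> sets D" using S(2) sets_D by auto
      show "T \<subseteq> U \<or> U \<subseteq> T" if "T \<in> S ` \<rat>" "U \<in> S ` \<rat>" for T U
        using that comp by blast
    qed
    then have lt: "prob B < exp (- 2 * real n * \<eta>\<^sup>2)" by simp
    have B: "B \<in> events"
      unfolding B_def using countable_rat S(2) sets_D by (intro sets_crossing) auto
    have "1 - exp (- 2 * real n * \<eta>\<^sup>2) < prob (space M - B)"
      using lt prob_compl[OF B] by simp
    then show ?thesis
      using B by (intro bexI[of _ "space M - B"]) (auto simp: B_def not_less)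
  qed
  have emp: "emp_cdf n y q \<le> measure D {..q} + \<eta> \<longleftrightarrow>
      real (card {i\<in>{1..n}. y i \<in> {..q}}) \<le> real n * (measure D {..q} + \<eta>)" for y q
    using n by (simp add: emp_cdf_eq_card field_simps)
  show ?upper
  proof -
    obtain G where G: "G \<in> sets M" "1 - exp (- 2 * real n * \<eta>\<^sup>2) < measure M G"
      "\<And>\<omega> q. \<omega> \<in> G \<Longrightarrow> q \<in> \<rat> \<Longrightarrow>
        real (card {i\<in>{1..n}. Ys i \<omega> \<in> {..q}}) \<le> real n * (measure D {..q} + \<eta>)"
      using good[of atMost] by (auto simp: monotone_def)
    have "emp_cdf n (\<lambda>i. Ys i \<omega>) t - cdf D t \<le> \<eta>" if \<omega>: "\<omega> \<in> G" for \<omega> t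
    proof (rule le_of_Rats_right_cont[of "\<lambda>t. emp_cdf n (\<lambda>i. Ys i \<omega>) t - cdf D t"])
      fix q :: real assume "q \<in> \<rat>"
      then show "emp_cdf n (\<lambda>i. Ys i \<omega>) q - cdf D q \<le> \<eta>"
        using G(3)[OF \<omega>, of q] unfolding emp[symmetric] by (simp add: cdf_def)
    next
      show "((\<lambda>t. emp_cdf n (\<lambda>i. Ys i \<omega>) t - cdf D t) \<longlongrightarrow>
          emp_cdf n (\<lambda>i. Ys i \<omega>) t - cdf D t) (at_right t)"
        using D.cdf_is_right_cont[of t] n
        by (intro tendsto_diff emp_cdf_right_cont) (auto simp: continuous_within)
    qed
    then show ?thesis using G by blast
  qed
  \<comment> \<open>Hits in \<open>{q<..}\<close> count the complement, so tail deviations are CDF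
    deviations with the sign reversed.\<close>
  have compl: "1 - emp_cdf n y q = real (card {i\<in>{1..n}. y i \<in> {q<..}}) / real n" for y q
  proof -
    have "card ({i\<in>{1..n}. y i \<le> q} \<union> {i\<in>{1..n}. y i \<in> {q<..}}) =
        card {i\<in>{1..n}. y i \<le> q} + card {i\<in>{1..n}. y i \<in> {q<..}}"
      by (intro card_Un_disjoint) auto
    moreover have "{i\<in>{1..n}. y i \<le> q} \<union> {i\<in>{1..n}. y i \<in> {q<..}} = {1..n}" by auto
    ultimately have "real n = real (card {i\<in>{1..n}. y i \<le> q}) + real (card {i\<in>{1..n}. y i \<in> {q<..}})"
      by simp
    then show ?thesis using n by (simp add: emp_cdf_eq_card field_simps)
  qed
  have D_compl: "measure D {q<..} = 1 - cdf D q" for q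
  proof -
    have "{q<..} = space D - {..q}" using space_D by auto
    then show ?thesis using D.prob_compl[of "{..q}"] sets_D by (simp add: cdf_def)
  qed
  show ?lower
  proof -
    obtain G where G: "G \<in> sets M" "1 - exp (- 2 * real n * \<eta>\<^sup>2) < measure M G"
      "\<And>\<omega> q. \<omega> \<in> G \<Longrightarrow> q \<in> \<rat> \<Longrightarrow>
        real (card {i\<in>{1..n}. Ys i \<omega> \<in> {q<..}}) \<le> real n * (measure D {q<..} + \<eta>)"
      using good[of greaterThan] by (auto simp: monotone_def)
    have "cdf D t - emp_cdf n (\<lambda>i. Ys i \<omega>) t \<le> \<eta>" if \<omega>: "\<omega> \<in> G" for \<omega> t
    proof (rule le_of_Rats_right_cont[of "\<lambda>t. cdf D t - emp_cdf n (\<lambda>i. Ys i \<omega>) t"])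
      fix q :: real assume "q \<in> \<rat>"
      then have "1 - emp_cdf n (\<lambda>i. Ys i \<omega>) q \<le> measure D {q<..} + \<eta>"
        unfolding compl using G(3)[OF \<omega>, of q] n by (simp add: field_simps)
      then show "cdf D q - emp_cdf n (\<lambda>i. Ys i \<omega>) q \<le> \<eta>"
        by (simp add: D_compl)
    next
      show "((\<lambda>t. cdf D t - emp_cdf n (\<lambda>i. Ys i \<omega>) t) \<longlongrightarrow>
          cdf D t - emp_cdf n (\<lambda>i. Ys i \<omega>) t) (at_right t)"
        using D.cdf_is_right_cont[of t] n
        by (intro tendsto_diff emp_cdf_right_cont) (auto simp: continuous_within)
    qed
    then show ?thesis using G by blast
  qed
qed

section \<open>Comparison of CVaRs\<close>

text \<open>The stop-loss transform. Scaled by the level \<beta>, the CVaR objective becomes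
  \<open>\<beta> * w + excess M X w\<close>, the form compared below.\<close>

definition excess :: "'a measure \<Rightarrow> ('a \<Rightarrow> real) \<Rightarrow> real \<Rightarrow> real" where
  "excess M X w = (\<integral>\<omega>. max (X \<omega> - w) 0 \<partial>M)"

context prob_space
begin

context
  fixes X :: "'a \<Rightarrow> real"
  assumes X[measurable]: "integrable M X"
begin

lemma integrable_excess: "integrable M (\<lambda>\<omega>. max (X \<omega> - w) 0)"
  using X by simp

lemma excess_nonneg: "0 \<le> excess M X w"
  unfolding excess_def by (intro integral_nonneg_AE) auto

lemma excess_antimono: "w \<le> v \<Longrightarrow> excess M X v \<le> excess M X w"
  unfolding excess_def by (intro integral_mono integrable_excess) auto

lemma expectation_le_excess: "expectation X - w \<le> excess M X w"
proof -
  have "expectation X - w = expectation (\<lambda>\<omega>. X \<omega> - w)"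
    using X by (simp add: prob_space)
  also have "\<dots> \<le> excess M X w"
    unfolding excess_def using X by (intro integral_mono integrable_excess) auto
  finally show ?thesis .
qed

lemma excess_eq_0:
  assumes "AE \<omega> in M. X \<omega> \<le> w"
  shows "excess M X w = 0"
  unfolding excess_def using assms by (intro integral_eq_zero_AE) auto

lemma excess_eq_expectation:
  assumes "AE \<omega> in M. w \<le> X \<omega>"
  shows "excess M X w = expectation X - w"
proof -
  have "excess M X w = expectation (\<lambda>\<omega>. X \<omega> - w)"
    unfolding excess_def using assms X by (intro integral_cong_AE) auto
  then show ?thesis using X by (simp add: prob_space)
qed

text \<open>Layer-cake formula: the difference of the positive parts at \<open>x\<close> is the
  length of the part of \<open>{w..v}\<close> below \<open>x\<close>, and Tonelli's theorem
  exchanges this length with the expectation, leaving the tail probability.\<close>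

lemma nn_integral_clip:
  assumes "w \<le> v"
  shows "ennreal (excess M X w - excess M X v) =
    (\<integral>\<^sup>+t\<in>{w..v}. ennreal (1 - cdf (distr M borel X) t) \<partial>lborel)"
proof -
  have clip: "ennreal (max (x - w) 0 - max (x - v) 0) = (\<integral>\<^sup>+t. indicator {w..v} t * indicator {..<x} t \<partial>lborel)"
    for x
  proof -
    have "(\<integral>\<^sup>+t. indicator {w..v} t * indicator {..<x} t \<partial>lborel) = emeasure lborel ({w..v} \<inter> {..<x})"
      by (simp add: indicator_inter_arith[symmetric])
    moreover consider "x \<le> w" | "w < x" "x \<le> v" | "v < x" by linarith
    then have "emeasure lborel ({w..v} \<inter> {..<x}) = ennreal (max (x - w) 0 - max (x - v) 0)"
    proof cases
      case 1
      then have "{w..v} \<inter> {..<x} = {}" by auto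
      then show ?thesis using 1 assms by simp
    next
      case 2
      then have "{w..v} \<inter> {..<x} = {w..<x}" by auto
      then show ?thesis using 2 by simp
    next
      case 3
      then have "{w..v} \<inter> {..<x} = {w..v}" by auto
      then show ?thesis using 3 assms by simp
    qed
    ultimately show ?thesis by simp
  qed
  have "excess M X w - excess M X v = expectation (\<lambda>\<omega>. max (X \<omega> - w) 0 - max (X \<omega> - v) 0)"
    unfolding excess_def using X by simp
  then have "ennreal (excess M X w - excess M X v) = (\<integral>\<^sup>+\<omega>. ennreal (max (X \<omega> - w) 0 - max (X \<omega> - v) 0) \<partial>M)"
    using X assms by (subst nn_integral_eq_integral) auto
  also have "\<dots> = (\<integral>\<^sup>+\<omega>. (\<integral>\<^sup>+t. indicator {w..v} t * indicator {..<X \<omega>} t \<partial>lborel) \<partial>M)"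
    by (simp add: clip)
  also have "\<dots> = (\<integral>\<^sup>+t. (\<integral>\<^sup>+\<omega>. indicator {w..v} t * indicator {..<X \<omega>} t \<partial>M) \<partial>lborel)"
  proof -
    interpret pair_sigma_finite M lborel ..
    have "Measurable.pred (M \<Otimes>\<^sub>M lborel) (\<lambda>x. snd x < X (fst x))" by measurable
    then have "(\<lambda>(\<omega>, t). indicator {w..v} t * indicator {..<X \<omega>} t :: ennreal) \<in> borel_measurable (M \<Otimes>\<^sub>M lborel)"
      unfolding indicator_def lessThan_iff case_prod_beta by measurable
    then show ?thesis by (rule Fubini'[symmetric])
  qed
  also have "\<dots> = (\<integral>\<^sup>+t\<in>{w..v}. ennreal (1 - cdf (distr M borel X) t) \<partial>lborel)"
  proof (intro nn_integral_cong)
    fix t :: real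
    have "(\<integral>\<^sup>+\<omega>. indicator {w..v} t * indicator {..<X \<omega>} t \<partial>M) =
        (\<integral>\<^sup>+\<omega>. indicator {w..v} t * indicator {\<omega>\<in>space M. t < X \<omega>} \<omega> \<partial>M)"
      by (intro nn_integral_cong) (auto split: split_indicator)
    also have "\<dots> = indicator {w..v} t * emeasure M {\<omega>\<in>space M. t < X \<omega>}"
      by (simp add: nn_integral_cmult)
    also have "emeasure M {\<omega>\<in>space M. t < X \<omega>} = ennreal (1 - cdf (distr M borel X) t)"
    proof -
      have "{\<omega>\<in>space M. t < X \<omega>} = space M - {\<omega>\<in>space M. X \<omega> \<le> t}" by auto
      then have "prob {\<omega>\<in>space M. t < X \<omega>} = 1 - prob {\<omega>\<in>space M. X \<omega> \<le> t}"
        by (simp add: prob_compl)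
      also have "prob {\<omega>\<in>space M. X \<omega> \<le> t} = cdf (distr M borel X) t"
        unfolding cdf_def by (subst measure_distr) (auto intro!: arg_cong[of _ _ prob])
      finally show ?thesis by (simp add: emeasure_eq_measure)
    qed
    finally show "(\<integral>\<^sup>+\<omega>. indicator {w..v} t * indicator {..<X \<omega>} t \<partial>M) =
      ennreal (1 - cdf (distr M borel X) t) * indicator {w..v} t" by (simp add: mult.commute)
  qed
  finally show ?thesis .
qed

lemma expectation_le_CVaR_objective:
  assumes "0 < \<beta>" "\<beta> \<le> 1"
  shows "expectation X \<le> w + 1 / \<beta> * excess M X w"
proof -
  have "1 * excess M X w \<le> 1 / \<beta> * excess M X w"
    using assms by (intro mult_right_mono excess_nonneg) auto
  then show ?thesis using expectation_le_excess[of w] by simp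
qed

lemma CVaR_bdd_below:
  assumes "0 < \<beta>" "\<beta> \<le> 1"
  shows "bdd_below (range (\<lambda>w. w + 1 / \<beta> * excess M X w))"
  using expectation_le_CVaR_objective[OF assms] by (intro bdd_belowI2)

text \<open>A real infimum is guaranteed to lie below the objective only when the objective is
  bounded below; for levels in (0,1] the expectation is such a bound.\<close>

lemma CVaR_le:
  assumes "0 < \<beta>" "\<beta> \<le> 1"
  shows "\<beta> * CVaR M \<beta> X \<le> \<beta> * w + excess M X w"
proof -
  have "CVaR M \<beta> X \<le> w + 1 / \<beta> * excess M X w"
    unfolding CVaR_def excess_def[symmetric] by (intro cINF_lower CVaR_bdd_below assms) auto
  then show ?thesis using assms by (simp add: field_simps)
qed

end

end

lemma CVaR_ge:
  assumes "0 < \<beta>" "\<And>w. z \<le> \<beta> * w + excess M X w"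
  shows "z \<le> \<beta> * CVaR M \<beta> X"
proof -
  have "z / \<beta> \<le> CVaR M \<beta> X"
    unfolding CVaR_def excess_def[symmetric]
  proof (rule cINF_greatest)
    fix w
    show "z / \<beta> \<le> w + 1 / \<beta> * excess M X w" using assms(1) assms(2)[of w] by (simp add: field_simps)
  qed simp
  then show ?thesis using assms(1) by (simp add: field_simps)
qed

text \<open>Closeness is one-sided: the upper bound takes the empirical variable as
  \<open>Z\<close>, the lower bounds take it as \<open>X\<close>. In the application \<epsilon>
  includes the sampling error.\<close>

locale cdf_close = X: prob_space M + Z: prob_space N for M :: "'a measure" and N :: "'b measure" +
  fixes X :: "'a \<Rightarrow> real" and Z :: "'b \<Rightarrow> real" and \<epsilon> :: real
  assumes X: "integrable M X" and Z: "integrable N Z" and \<epsilon>: "0 \<le> \<epsilon>"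
    and close: "\<And>t. cdf (distr N borel Z) t - cdf (distr M borel X) t \<le> \<epsilon>"
begin

text \<open>Both differences are integrals of \<open>1 - cdf\<close> over \<open>{w..v}\<close>, and
  the integrand for \<open>X\<close> exceeds the one for \<open>Z\<close> by at most
  \<epsilon>.\<close>

lemma excess_diff_le:
  assumes "w \<le> v"
  shows "excess M X w - excess M X v \<le> excess N Z w - excess N Z v + \<epsilon> * (v - w)"
proof -
  have nn: "0 \<le> excess N Z w - excess N Z v" using Z.excess_antimono[OF Z assms] by simp
  interpret dZ: real_distribution "distr N borel Z"
    using Z by (intro Z.real_distribution_distr borel_measurable_integrable)
  have [measurable]: "cdf (distr N borel Z) \<in> borel_measurable borel"
    by (intro borel_measurable_mono monoI dZ.cdf_nondecreasing)
  have "ennreal (excess M X w - excess M X v) =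
      (\<integral>\<^sup>+t\<in>{w..v}. ennreal (1 - cdf (distr M borel X) t) \<partial>lborel)"
    by (rule X.nn_integral_clip[OF X assms])
  also have "\<dots> \<le> (\<integral>\<^sup>+t. ennreal (1 - cdf (distr N borel Z) t) * indicator {w..v} t + ennreal \<epsilon> * indicator {w..v} t \<partial>lborel)"
  proof (intro nn_integral_mono)
    fix t
    have "ennreal (1 - cdf (distr M borel X) t) \<le> ennreal (1 - cdf (distr N borel Z) t + \<epsilon>)"
      using close[of t] by (intro ennreal_leI) simp
    also have "\<dots> = ennreal (1 - cdf (distr N borel Z) t) + ennreal \<epsilon>"
      using dZ.cdf_bounded_prob[of t] \<epsilon> by (intro ennreal_plus) auto
    finally show "ennreal (1 - cdf (distr M borel X) t) * indicator {w..v} t \<le>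
        ennreal (1 - cdf (distr N borel Z) t) * indicator {w..v} t + ennreal \<epsilon> * indicator {w..v} t"
      by (auto split: split_indicator)
  qed
  also have "\<dots> = ennreal (excess N Z w - excess N Z v) + ennreal \<epsilon> * ennreal (v - w)"
    unfolding Z.nn_integral_clip[OF Z assms]
    using assms by (subst nn_integral_add) (auto simp: nn_integral_cmult)
  also have "\<dots> = ennreal (excess N Z w - excess N Z v + \<epsilon> * (v - w))"
    using nn \<epsilon> assms by (simp add: ennreal_mult ennreal_plus)
  finally show ?thesis
    using nn \<epsilon> assms by (subst (asm) ennreal_le_iff) auto
qed

text \<open>Every \<open>w\<close> in the infimum for \<open>Z\<close> yields a test point for
  \<open>X\<close>: \<open>w\<close> itself if \<open>w \<le> b\<close>, otherwise \<open>b\<close>.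
  In the first case both excesses vanish at \<open>b\<close>, so the comparison costs
  \<open>\<epsilon> * (b - w)\<close>; this lowers the weight of \<open>w\<close> from \<alpha> to
  \<open>\<alpha> - \<epsilon>\<close> and leaves \<open>\<epsilon> * b\<close>.\<close>

lemma CVaR_upper:
  assumes "\<epsilon> < \<alpha>" "\<alpha> \<le> 1" "AE \<omega> in M. X \<omega> \<le> b" "AE \<omega> in N. Z \<omega> \<le> b"
  shows "\<alpha> * CVaR M \<alpha> X \<le> \<epsilon> * b + (\<alpha> - \<epsilon>) * CVaR N (\<alpha> - \<epsilon>) Z"
proof -
  have \<alpha>: "0 < \<alpha>" using assms(1) \<epsilon> by simp
  have "\<alpha> * CVaR M \<alpha> X - \<epsilon> * b \<le> (\<alpha> - \<epsilon>) * CVaR N (\<alpha> - \<epsilon>) Z"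
  proof (rule CVaR_ge)
    fix w
    show "\<alpha> * CVaR M \<alpha> X - \<epsilon> * b \<le> (\<alpha> - \<epsilon>) * w + excess N Z w"
    proof (cases "w \<le> b")
      case True
      have "excess M X w \<le> excess N Z w + \<epsilon> * (b - w)"
        using excess_diff_le[OF True] X.excess_eq_0[OF X assms(3)] Z.excess_eq_0[OF Z assms(4)] by simp
      then show ?thesis
        using X.CVaR_le[OF X \<alpha> assms(2), of w] by (simp add: algebra_simps)
    next
      case False
      have "\<alpha> * CVaR M \<alpha> X - \<epsilon> * b \<le> (\<alpha> - \<epsilon>) * b"
        using X.CVaR_le[OF X \<alpha> assms(2), of b] X.excess_eq_0[OF X assms(3)] by (simp add: algebra_simps)
      also have "\<dots> \<le> (\<alpha> - \<epsilon>) * w" using False assms(1) by (intro mult_left_mono) auto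
      finally show ?thesis using Z.excess_nonneg[OF Z, of w] by simp
    qed
  qed (use assms in simp)
  then show ?thesis by simp
qed

text \<open>Test points \<open>w\<close> at level \<alpha> and \<open>v\<close> at level \<epsilon>
  combine into \<open>min v w\<close> at level \<open>\<alpha> + \<epsilon>\<close>. For
  \<open>w \<le> v\<close> the cost \<open>\<epsilon> * (v - w)\<close> converts
  \<open>\<epsilon> * w\<close> into \<open>\<epsilon> * v\<close>; for \<open>v < w\<close> the
  excess of \<open>X\<close> at \<open>v\<close> cancels.\<close>

lemma excess_min_le:
  assumes "0 \<le> \<alpha>"
  shows "(\<alpha> + \<epsilon>) * min v w + excess M X (min v w) \<le>
    (\<alpha> * w + excess N Z w) + (\<epsilon> * v + excess M X v)"
proof (cases "w \<le> v")
  case True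
  then show ?thesis using excess_diff_le[OF True] Z.excess_nonneg[OF Z, of v] by (simp add: algebra_simps)
next
  case False
  then have "\<alpha> * v \<le> \<alpha> * w" using assms by (intro mult_left_mono) auto
  then show ?thesis using False Z.excess_nonneg[OF Z, of w] by (simp add: algebra_simps)
qed

text \<open>In the two lower bounds the roles are exchanged: \<open>Z\<close> is the variable whose CVaR is bounded.\<close>

lemma CVaR_lower:
  assumes "0 < \<alpha>" "0 < \<epsilon>" "\<alpha> + \<epsilon> \<le> 1"
  shows "(\<alpha> + \<epsilon>) * CVaR M (\<alpha> + \<epsilon>) X - \<epsilon> * CVaR M \<epsilon> X \<le> \<alpha> * CVaR N \<alpha> Z"
proof (rule CVaR_ge)
  fix w
  \<comment> \<open>With \<open>w\<close> fixed, the infimum over \<open>v\<close> is treated;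
    \<open>min v w\<close> is the test point at level \<open>\<alpha> + \<epsilon>\<close>, which is
    at most 1.\<close>
  have "(\<alpha> + \<epsilon>) * CVaR M (\<alpha> + \<epsilon>) X - (\<alpha> * w + excess N Z w) \<le> \<epsilon> * CVaR M \<epsilon> X"
  proof (rule CVaR_ge)
    fix v
    have "(\<alpha> + \<epsilon>) * CVaR M (\<alpha> + \<epsilon>) X \<le> (\<alpha> + \<epsilon>) * min v w + excess M X (min v w)"
      using assms by (intro X.CVaR_le X) auto
    also note excess_min_le[of \<alpha> v w]
    finally show "(\<alpha> + \<epsilon>) * CVaR M (\<alpha> + \<epsilon>) X - (\<alpha> * w + excess N Z w) \<le> \<epsilon> * v + excess M X v"
      using assms by simp
  qed (use assms in simp)
  then show "(\<alpha> + \<epsilon>) * CVaR M (\<alpha> + \<epsilon>) X - \<epsilon> * CVaR M \<epsilon> X \<le> \<alpha> * w + excess N Z w" by simp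
qed (use assms in simp)

end

text \<open>Below an almost sure lower bound \<open>a\<close> the excess has slope -1, so the
  objective has slope \<open>\<beta> - 1 \<le> 0\<close> and raising \<open>w\<close> to
  \<open>a\<close> does not increase it.\<close>

lemma (in prob_space) excess_objective_max:
  assumes X: "integrable M X" and "AE \<omega> in M. a \<le> X \<omega>" "\<beta> \<le> 1"
  shows "\<beta> * max w a + excess M X (max w a) \<le> \<beta> * w + excess M X w"
proof (cases "a \<le> w")
  case False
  have "AE \<omega> in M. w \<le> X \<omega>" using assms(2) by eventually_elim (use False in simp)
  then have "excess M X w = expectation X - w" "excess M X a = expectation X - a"
    using assms by (auto intro!: excess_eq_expectation)
  moreover have "(1 - \<beta>) * w \<le> (1 - \<beta>) * a" using False assms by (intro mult_left_mono) auto
  ultimately show ?thesis using False by (simp add: algebra_simps max_def)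
qed (simp add: max_def)

text \<open>Above level 1 the combined objective at \<open>u\<close> is bounded through the mean, by
  \<open>E X + (\<alpha> + \<epsilon> - 1) * u\<close>. The coefficient is positive, so a lower
  bound on \<open>u\<close> is called for, whence the term with \<open>a\<close>.\<close>

lemma (in cdf_close) CVaR_lower_mean:
  assumes "0 < \<alpha>" "0 < \<epsilon>" "\<alpha> \<le> 1" "\<epsilon> \<le> 1" "1 < \<alpha> + \<epsilon>"
    and aX: "AE \<omega> in M. a \<le> X \<omega>" and aZ: "AE \<omega> in N. a \<le> Z \<omega>"
  shows "X.expectation X - \<epsilon> * CVaR M \<epsilon> X + (\<alpha> + \<epsilon> - 1) * a \<le> \<alpha> * CVaR N \<alpha> Z"
proof (rule CVaR_ge)
  fix w
  have "X.expectation X + (\<alpha> + \<epsilon> - 1) * a - (\<alpha> * w + excess N Z w) \<le> \<epsilon> * CVaR M \<epsilon> X"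
  proof (rule CVaR_ge)
    fix v
    \<comment> \<open>Truncating both points at \<open>a\<close> ensures \<open>?u \<ge> a\<close>,
      and by \<open>excess_objective_max\<close> neither objective grows.\<close>
    let ?u = "min (max v a) (max w a)"
    have "(\<alpha> + \<epsilon> - 1) * a \<le> (\<alpha> + \<epsilon> - 1) * ?u"
      using assms by (intro mult_left_mono) auto
    then have "X.expectation X + (\<alpha> + \<epsilon> - 1) * a \<le> (\<alpha> + \<epsilon>) * ?u + excess M X ?u"
      using X.expectation_le_excess[OF X, of ?u] by (simp add: algebra_simps)
    also have "\<dots> \<le> (\<alpha> * max w a + excess N Z (max w a)) + (\<epsilon> * max v a + excess M X (max v a))"
      using assms by (intro excess_min_le) auto
    also have "\<dots> \<le> (\<alpha> * w + excess N Z w) + (\<epsilon> * v + excess M X v)"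
      using assms by (intro add_mono Z.excess_objective_max X.excess_objective_max X Z) auto
    finally show "X.expectation X + (\<alpha> + \<epsilon> - 1) * a - (\<alpha> * w + excess N Z w) \<le> \<epsilon> * v + excess M X v"
      by simp
  qed (use assms in simp)
  then show "X.expectation X - \<epsilon> * CVaR M \<epsilon> X + (\<alpha> + \<epsilon> - 1) * a \<le> \<alpha> * w + excess N Z w" by simp
qed (use assms in simp)

section \<open>Concentration bounds for CVaR\<close>

abbreviation emp_measure :: "nat \<Rightarrow> (nat \<Rightarrow> real) \<Rightarrow> real measure" where
  "emp_measure n y \<equiv> measure_pmf (map_pmf y (pmf_of_set {1..n}))"

lemma integrable_emp_measure: "1 \<le> n \<Longrightarrow> integrable (emp_measure n y) (\<lambda>x. x)"
  by (intro integrable_measure_pmf_finite) simp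

lemma cdf_distr_emp_measure:
  assumes "1 \<le> n"
  shows "cdf (distr (emp_measure n y) borel (\<lambda>x. x)) = emp_cdf n y"
proof
  fix t
  show "cdf (distr (emp_measure n y) borel (\<lambda>x. x)) t = emp_cdf n y t"
    unfolding emp_cdf_eq_cdf[OF assms] unfolding cdf_def
    by (subst measure_distr) (auto simp: vimage_def atMost_def)
qed

lemma AE_emp_measure_iff: "1 \<le> n \<Longrightarrow> (AE x in emp_measure n y. P x) \<longleftrightarrow> (\<forall>i\<in>{1..n}. P (y i))"
  by (simp add: AE_measure_pmf_iff)

text \<open>The set where \<open>f\<close> is at least the rational infimum is closed and contains a
  dense set. A countable infimum makes the empirical CVaR measurable.\<close>

lemma INF_Rats_eq_INF:
  fixes f :: "real \<Rightarrow> real"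
  assumes cont: "continuous_on UNIV f" and bdd: "bdd_below (range f)"
  shows "(INF q\<in>\<rat>. f q) = (INF w. f w)"
proof (rule antisym)
  have bddQ: "bdd_below (f ` \<rat>)" using bdd by (rule bdd_below_mono) auto
  show "(INF q\<in>\<rat>. f q) \<le> (INF w. f w)"
  proof (rule cINF_greatest)
    fix w
    have "closed {w. (INF q\<in>\<rat>. f q) \<le> f w}"
      using cont by (intro closed_Collect_le continuous_on_const)
    moreover have "\<rat> \<subseteq> {w. (INF q\<in>\<rat>. f q) \<le> f w}"
      using bddQ by (auto intro: cINF_lower)
    ultimately have "closure \<rat> \<subseteq> {w. (INF q\<in>\<rat>. f q) \<le> f w}"
      by (rule closure_minimal[rotated])
    then show "(INF q\<in>\<rat>. f q) \<le> f w"
      unfolding Rats_closure_real by auto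
  qed simp
  show "(INF w. f w) \<le> (INF q\<in>\<rat>. f q)"
    using bdd by (intro cINF_superset_mono) auto
qed

text \<open>\<open>measure\<close> is 0 on non-measurable sets, so the strict probability bounds
  require measurable events.\<close>

lemma borel_measurable_emp_CVaR:
  assumes Ys: "\<And>i. i \<in> {1..n} \<Longrightarrow> Ys i \<in> borel_measurable M" and n: "1 \<le> n"
    and \<beta>: "0 < \<beta>" "\<beta> \<le> 1"
  shows "(\<lambda>\<omega>. emp_CVaR n (\<lambda>i. Ys i \<omega>) \<beta>) \<in> borel_measurable M"
proof -
  note [measurable] = Ys
  have "emp_CVaR n y \<beta> = (INF q\<in>\<rat>. q + 1 / (real n * \<beta>) * (\<Sum>i=1..n. max (y i - q) 0))" for y
    unfolding emp_CVaR_def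
  proof (rule INF_Rats_eq_INF[symmetric])
    show "continuous_on UNIV (\<lambda>w. w + 1 / (real n * \<beta>) * (\<Sum>i=1..n. max (y i - w) 0))"
      by (intro continuous_intros)
    \<comment> \<open>Reading the sum as an excess under the uniform law on the sample gives
      boundedness below.\<close>
    have "excess (emp_measure n y) (\<lambda>x. x) w = 1 / real n * (\<Sum>i=1..n. max (y i - w) 0)" for w
      using n by (simp add: excess_def integral_pmf_of_set)
    then have objective: "(\<lambda>w. w + 1 / (real n * \<beta>) * (\<Sum>i=1..n. max (y i - w) 0)) =
        (\<lambda>w. w + 1 / \<beta> * excess (emp_measure n y) (\<lambda>x. x) w)"
      by (simp add: mult.commute)
    show "bdd_below (range (\<lambda>w. w + 1 / (real n * \<beta>) * (\<Sum>i=1..n. max (y i - w) 0)))"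
      unfolding objective
      by (rule prob_space.CVaR_bdd_below[OF prob_space_measure_pmf integrable_emp_measure[OF n] \<beta>])
  qed
  then show ?thesis
    by (simp, intro borel_measurable_cINF_real countable_rat) measurable
qed

lemma (in prob_space) prob_gt_of_AE_good:
  assumes "G \<in> events" "c < prob G" "{\<omega> \<in> space M. P \<omega>} \<in> events" "AE \<omega> in M. \<omega> \<in> G \<longrightarrow> P \<omega>"
  shows "c < prob {\<omega> \<in> space M. P \<omega>}"
proof -
  have "AE \<omega> in M. \<omega> \<in> G \<longrightarrow> \<omega> \<in> {\<omega> \<in> space M. P \<omega>}"
    using assms(4) AE_space by eventually_elim auto
  then have "prob G \<le> prob {\<omega> \<in> space M. P \<omega>}"
    using assms(3) by (rule finite_measure_mono_AE)
  then show ?thesis using assms(2) by simp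
qed

theorem theorem5p7:
  fixes MX :: "'a measure" and MY :: "'b measure" and M :: "'c measure"
    and X :: "'a \<Rightarrow> real" and Y :: "'b \<Rightarrow> real" and Ys :: "nat \<Rightarrow> 'c \<Rightarrow> real"
    and F_X F_Y :: "real \<Rightarrow> real"
    and a_X a_Y b_X b_Y \<alpha> \<epsilon> \<delta> \<eta> \<epsilon>' :: real
    and n :: nat
  assumes "prob_space MX" and "prob_space MY" and "prob_space M"
    and "integrable MX X" and "integrable MY Y"
    and "F_X = cdf (distr MX borel X)" and "F_Y = cdf (distr MY borel Y)"
    and "0 < \<alpha>" "\<alpha> < 1"
    and "0 \<le> \<epsilon>" "\<epsilon> \<le> 1"
    and "0 < \<delta>" "\<delta> < 0.5"
    and "n \<ge> 1"
    and "\<eta> = sqrt (ln (1 / \<delta>) / (2 * real n))"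
    and "\<epsilon>' = min (\<epsilon> + \<eta>) 1"
    and "prob_space.indep_vars M (\<lambda>_. borel) Ys {1..n}"
    and "\<And>i. i \<in> {1..n} \<Longrightarrow> distr M borel (Ys i) = distr MY borel Y"
  shows
    "((\<forall>z. F_Y z - F_X z \<le> \<epsilon>) \<and> \<P>(\<omega> in MX. X \<omega> \<le> b_X) = 1 \<and> \<P>(\<omega> in MY. Y \<omega> \<le> b_Y) = 1 \<longrightarrow>
       (\<alpha> > \<epsilon>' \<longrightarrow>
          \<P>(\<omega> in M. CVaR MX \<alpha> X
                \<le> \<epsilon>' / \<alpha> * max b_X b_Y
                  + (1 - \<epsilon>' / \<alpha>) * emp_CVaR n (\<lambda>i. Ys i \<omega>) (\<alpha> - \<epsilon>')) > 1 - \<delta>) \<and>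
       (\<alpha> \<le> \<epsilon>' \<longrightarrow> CVaR MX \<alpha> X \<le> max b_X b_Y))
     \<and>
     ((\<forall>z. F_X z - F_Y z \<le> \<epsilon>) \<and> \<P>(\<omega> in MX. X \<omega> \<ge> a_X) = 1 \<and> \<P>(\<omega> in MY. Y \<omega> \<ge> a_Y) = 1 \<longrightarrow>
       (\<alpha> + \<epsilon>' \<le> 1 \<longrightarrow>
          \<P>(\<omega> in M. CVaR MX \<alpha> X
                \<ge> (1 + \<epsilon>' / \<alpha>) * emp_CVaR n (\<lambda>i. Ys i \<omega>) (\<alpha> + \<epsilon>')
                  - \<epsilon>' / \<alpha> * emp_CVaR n (\<lambda>i. Ys i \<omega>) \<epsilon>') > 1 - \<delta>) \<and>
       (\<alpha> + \<epsilon>' > 1 \<longrightarrow>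
          \<P>(\<omega> in M. CVaR MX \<alpha> X
                \<ge> 1 / \<alpha> * (emp_mean n (\<lambda>i. Ys i \<omega>)
                           - \<epsilon>' * emp_CVaR n (\<lambda>i. Ys i \<omega>) \<epsilon>'
                           + (\<alpha> + \<epsilon>' - 1) * min a_X a_Y)) > 1 - \<delta>))"
proof -
  interpret MX: prob_space MX by fact
  interpret MY: prob_space MY by fact
  interpret M: prob_space M by fact
  note X = \<open>integrable MX X\<close> and Y = \<open>integrable MY Y\<close> and n = \<open>n \<ge> 1\<close>
  note \<alpha> = \<open>0 < \<alpha>\<close> \<open>\<alpha> < 1\<close> and \<epsilon> = \<open>0 \<le> \<epsilon>\<close> and F = \<open>F_X = _\<close> \<open>F_Y = _\<close>
  have [measurable]: "X \<in> borel_measurable MX" "Y \<in> borel_measurable MY" using X Y by auto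
  have Ys: "Ys i \<in> borel_measurable M" if "i \<in> {1..n}" for i
    using assms(17) that unfolding M.indep_vars_def by blast
  note [measurable] = Ys
  have ln_pos: "0 < ln (1 / \<delta>)" using \<open>0 < \<delta>\<close> \<open>\<delta> < 0.5\<close> by simp
  have \<eta>: "0 < \<eta>" using ln_pos n by (simp add: \<open>\<eta> = _\<close>)
  \<comment> \<open>\<eta> is chosen so that the bound on the failure probability is exactly
    \<delta>.\<close>
  have "2 * real n * \<eta>\<^sup>2 = ln (1 / \<delta>)" using ln_pos n by (simp add: \<open>\<eta> = _\<close>)
  then have exp_\<eta>: "exp (- 2 * real n * \<eta>\<^sup>2) = \<delta>"
    using \<open>0 < \<delta>\<close> by (simp add: exp_minus)
  \<comment> \<open>Positivity of \<eta> makes \<epsilon>' a valid CVaR level even when \<epsilon> =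
    0.\<close>
  have \<epsilon>': "0 < \<epsilon>'" "\<epsilon>' \<le> 1" using \<epsilon> \<eta> by (auto simp: \<open>\<epsilon>' = _\<close>)
  note dkw = iid_dkw_good_event[OF \<open>prob_space M\<close> assms(17,18) n \<eta>, unfolded exp_\<eta> F(2)[symmetric]]
  interpret dX: real_distribution "distr MX borel X" by (intro MX.real_distribution_distr) measurable
  let ?N = "\<lambda>\<omega>. emp_measure n (\<lambda>i. Ys i \<omega>)"
  have cdf_N: "cdf (distr (?N \<omega>) borel (\<lambda>x. x)) = emp_cdf n (\<lambda>i. Ys i \<omega>)" for \<omega>
    by (rule cdf_distr_emp_measure[OF n])
  have emp_le_1: "emp_cdf n y t \<le> 1" and emp_nonneg: "0 \<le> emp_cdf n y t" for y t
    by (simp_all add: emp_cdf_eq_cdf[OF n] cdf_def)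
  \<comment> \<open>Support bounds on \<open>Y\<close> pass to the sample through the equality of
    laws.\<close>
  have AE_Ys: "AE \<omega> in M. \<forall>i\<in>{1..n}. P (Ys i \<omega>)"
    if P: "Measurable.pred borel P" "AE \<omega> in MY. P (Y \<omega>)" for P
  proof (rule AE_finite_allI)
    fix i assume i: "i \<in> {1..n}"
    have "AE y in distr M borel (Ys i). P y"
      unfolding assms(18)[OF i] using P by (subst AE_distr_iff) (auto simp: pred_def)
    then show "AE \<omega> in M. P (Ys i \<omega>)"
      using P(1) Ys[OF i] by (subst (asm) AE_distr_iff) (auto simp: pred_def)
  qed simp
  show ?thesis
  proof (intro conjI impI; elim conjE)
    assume FXY: "\<forall>z. F_Y z - F_X z \<le> \<epsilon>" and bX: "\<P>(\<omega> in MX. X \<omega> \<le> b_X) = 1"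
      and bY: "\<P>(\<omega> in MY. Y \<omega> \<le> b_Y) = 1" and lt: "\<alpha> > \<epsilon>'"
    let ?b = "max b_X b_Y"
    have AE_X: "AE \<omega> in MX. X \<omega> \<le> ?b"
      using MX.prob_Collect_eq_1[THEN iffD1, OF _ bX] by (auto elim: eventually_mono)
    have AE_Y: "AE \<omega> in M. \<forall>i\<in>{1..n}. Ys i \<omega> \<le> ?b"
      using MY.prob_Collect_eq_1[THEN iffD1, OF _ bY] by (intro AE_Ys) (auto elim: eventually_mono)
    obtain G where G: "G \<in> sets M" "1 - \<delta> < measure M G"
      "\<And>\<omega> t. \<omega> \<in> G \<Longrightarrow> emp_cdf n (\<lambda>i. Ys i \<omega>) t - F_Y t \<le> \<eta>" using dkw(1) by blast
    show "\<P>(\<omega> in M. CVaR MX \<alpha> X \<le> \<epsilon>' / \<alpha> * ?b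
        + (1 - \<epsilon>' / \<alpha>) * emp_CVaR n (\<lambda>i. Ys i \<omega>) (\<alpha> - \<epsilon>')) > 1 - \<delta>"
    proof (rule M.prob_gt_of_AE_good[OF G(1,2)])
      have "(\<lambda>\<omega>. emp_CVaR n (\<lambda>i. Ys i \<omega>) (\<alpha> - \<epsilon>')) \<in> borel_measurable M"
        using lt \<alpha> \<epsilon>' by (intro borel_measurable_emp_CVaR Ys n) auto
      then show "{\<omega> \<in> space M. CVaR MX \<alpha> X \<le> \<epsilon>' / \<alpha> * ?b
          + (1 - \<epsilon>' / \<alpha>) * emp_CVaR n (\<lambda>i. Ys i \<omega>) (\<alpha> - \<epsilon>')} \<in> sets M" by measurable
      show "AE \<omega> in M. \<omega> \<in> G \<longrightarrow> CVaR MX \<alpha> X \<le> \<epsilon>' / \<alpha> * ?b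
          + (1 - \<epsilon>' / \<alpha>) * emp_CVaR n (\<lambda>i. Ys i \<omega>) (\<alpha> - \<epsilon>')"
        using AE_Y
      proof (eventually_elim, intro impI)
        fix \<omega> assume le: "\<forall>i\<in>{1..n}. Ys i \<omega> \<le> ?b" and \<omega>: "\<omega> \<in> G"
        interpret cdf_close MX "?N \<omega>" X "\<lambda>x. x" \<epsilon>'
        proof
          \<comment> \<open>The difference is at most \<open>\<epsilon> + \<eta>\<close> by way of
            \<open>F_Y\<close>, and at most 1 because CDF values lie in [0,1]; this matches the
            minimum in \<epsilon>'.\<close>
          show "cdf (distr (?N \<omega>) borel (\<lambda>x. x)) t - cdf (distr MX borel X) t \<le> \<epsilon>'" for t
            using G(3)[OF \<omega>, of t] FXY[rule_format, of t] emp_le_1[of "\<lambda>i. Ys i \<omega>" t] dX.cdf_nonneg[of t]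
            unfolding cdf_N F(1)[symmetric] \<open>\<epsilon>' = _\<close> by (simp add: F(1))
        qed (use X integrable_emp_measure[OF n] \<epsilon>' in auto)
        have "\<alpha> * CVaR MX \<alpha> X \<le> \<epsilon>' * ?b + (\<alpha> - \<epsilon>') * CVaR (?N \<omega>) (\<alpha> - \<epsilon>') (\<lambda>x. x)"
          using lt \<alpha> AE_X le by (intro CVaR_upper) (auto simp: AE_emp_measure_iff[OF n])
        then show "CVaR MX \<alpha> X \<le> \<epsilon>' / \<alpha> * ?b
            + (1 - \<epsilon>' / \<alpha>) * emp_CVaR n (\<lambda>i. Ys i \<omega>) (\<alpha> - \<epsilon>')"
          unfolding emp_CVaR_eq_CVaR[OF n, symmetric] using \<alpha>(1) by (simp add: field_simps)
      qed
    qed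
  next
    assume bX: "\<P>(\<omega> in MX. X \<omega> \<le> b_X) = 1"
    let ?b = "max b_X b_Y"
    have "AE \<omega> in MX. X \<omega> \<le> ?b"
      using MX.prob_Collect_eq_1[THEN iffD1, OF _ bX] by (auto elim: eventually_mono)
    \<comment> \<open>The deterministic case: the excess vanishes at the test point
      \<open>max b_X b_Y\<close>.\<close>
    then have "\<alpha> * CVaR MX \<alpha> X \<le> \<alpha> * ?b"
      using MX.CVaR_le[OF X, of \<alpha> ?b] MX.excess_eq_0[OF X, of ?b] \<alpha> by simp
    then show "CVaR MX \<alpha> X \<le> ?b" using \<alpha> by simp
  next
    assume FXY: "\<forall>z. F_X z - F_Y z \<le> \<epsilon>" and le: "\<alpha> + \<epsilon>' \<le> 1"
    obtain G where G: "G \<in> sets M" "1 - \<delta> < measure M G"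
      "\<And>\<omega> t. \<omega> \<in> G \<Longrightarrow> F_Y t - emp_cdf n (\<lambda>i. Ys i \<omega>) t \<le> \<eta>" using dkw(2) by blast
    show "\<P>(\<omega> in M. CVaR MX \<alpha> X \<ge> (1 + \<epsilon>' / \<alpha>) * emp_CVaR n (\<lambda>i. Ys i \<omega>) (\<alpha> + \<epsilon>')
        - \<epsilon>' / \<alpha> * emp_CVaR n (\<lambda>i. Ys i \<omega>) \<epsilon>') > 1 - \<delta>"
    proof (rule M.prob_gt_of_AE_good[OF G(1,2) _ AE_I2])
      have "(\<lambda>\<omega>. emp_CVaR n (\<lambda>i. Ys i \<omega>) (\<alpha> + \<epsilon>')) \<in> borel_measurable M"
        "(\<lambda>\<omega>. emp_CVaR n (\<lambda>i. Ys i \<omega>) \<epsilon>') \<in> borel_measurable M"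
        using le \<alpha> \<epsilon>' by (auto intro!: borel_measurable_emp_CVaR Ys n)
      then show "{\<omega> \<in> space M. CVaR MX \<alpha> X \<ge> (1 + \<epsilon>' / \<alpha>) * emp_CVaR n (\<lambda>i. Ys i \<omega>) (\<alpha> + \<epsilon>')
          - \<epsilon>' / \<alpha> * emp_CVaR n (\<lambda>i. Ys i \<omega>) \<epsilon>'} \<in> sets M" by measurable
      show "\<omega> \<in> G \<longrightarrow> CVaR MX \<alpha> X \<ge> (1 + \<epsilon>' / \<alpha>) * emp_CVaR n (\<lambda>i. Ys i \<omega>) (\<alpha> + \<epsilon>')
          - \<epsilon>' / \<alpha> * emp_CVaR n (\<lambda>i. Ys i \<omega>) \<epsilon>'" for \<omega>
      proof
        assume \<omega>: "\<omega> \<in> G"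
        \<comment> \<open>Here the empirical variable is the \<open>X\<close> of the locale, and the
          original \<open>X\<close> is its \<open>Z\<close>.\<close>
        interpret cdf_close "?N \<omega>" MX "\<lambda>x. x" X \<epsilon>'
        proof
          show "cdf (distr MX borel X) t - cdf (distr (?N \<omega>) borel (\<lambda>x. x)) t \<le> \<epsilon>'" for t
            using G(3)[OF \<omega>, of t] FXY[rule_format, of t] emp_nonneg[of "\<lambda>i. Ys i \<omega>" t] dX.cdf_bounded_prob[of t]
            unfolding cdf_N F(1)[symmetric] \<open>\<epsilon>' = _\<close> by (simp add: F(1))
        qed (use X integrable_emp_measure[OF n] \<epsilon>' in auto)
        have bound: "(\<alpha> + \<epsilon>') * CVaR (?N \<omega>) (\<alpha> + \<epsilon>') (\<lambda>x. x) - \<epsilon>' * CVaR (?N \<omega>) \<epsilon>' (\<lambda>x. x) \<le> \<alpha> * CVaR MX \<alpha> X"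
          using le \<alpha> \<epsilon>' by (intro CVaR_lower) auto
        have scale: "(1 + \<epsilon>' / \<alpha>) * u - \<epsilon>' / \<alpha> * v = ((\<alpha> + \<epsilon>') * u - \<epsilon>' * v) / \<alpha>" for u v
          using \<alpha>(1) by (simp add: field_simps)
        from bound show "CVaR MX \<alpha> X \<ge> (1 + \<epsilon>' / \<alpha>) * emp_CVaR n (\<lambda>i. Ys i \<omega>) (\<alpha> + \<epsilon>')
          - \<epsilon>' / \<alpha> * emp_CVaR n (\<lambda>i. Ys i \<omega>) \<epsilon>'"
          unfolding emp_CVaR_eq_CVaR[OF n, symmetric] scale using \<alpha>(1)
          by (subst pos_divide_le_eq) (auto simp: mult.commute)
      qed
    qed
  next
    assume FXY: "\<forall>z. F_X z - F_Y z \<le> \<epsilon>" and aX: "\<P>(\<omega> in MX. X \<omega> \<ge> a_X) = 1"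
      and aY: "\<P>(\<omega> in MY. Y \<omega> \<ge> a_Y) = 1" and gt: "\<alpha> + \<epsilon>' > 1"
    let ?a = "min a_X a_Y"
    have AE_X: "AE \<omega> in MX. ?a \<le> X \<omega>"
      using MX.prob_Collect_eq_1[THEN iffD1, OF _ aX] by (auto elim: eventually_mono)
    have AE_Y: "AE \<omega> in M. \<forall>i\<in>{1..n}. ?a \<le> Ys i \<omega>"
      using MY.prob_Collect_eq_1[THEN iffD1, OF _ aY] by (intro AE_Ys) (auto elim: eventually_mono)
    obtain G where G: "G \<in> sets M" "1 - \<delta> < measure M G"
      "\<And>\<omega> t. \<omega> \<in> G \<Longrightarrow> F_Y t - emp_cdf n (\<lambda>i. Ys i \<omega>) t \<le> \<eta>" using dkw(2) by blast
    show "\<P>(\<omega> in M. CVaR MX \<alpha> X \<ge> 1 / \<alpha> * (emp_mean n (\<lambda>i. Ys i \<omega>)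
        - \<epsilon>' * emp_CVaR n (\<lambda>i. Ys i \<omega>) \<epsilon>' + (\<alpha> + \<epsilon>' - 1) * ?a)) > 1 - \<delta>"
    proof (rule M.prob_gt_of_AE_good[OF G(1,2)])
      have "(\<lambda>\<omega>. emp_CVaR n (\<lambda>i. Ys i \<omega>) \<epsilon>') \<in> borel_measurable M"
        using \<epsilon>' by (intro borel_measurable_emp_CVaR Ys n) auto
      moreover have "(\<lambda>\<omega>. emp_mean n (\<lambda>i. Ys i \<omega>)) \<in> borel_measurable M"
        unfolding emp_mean_def by measurable
      ultimately show "{\<omega> \<in> space M. CVaR MX \<alpha> X \<ge> 1 / \<alpha> * (emp_mean n (\<lambda>i. Ys i \<omega>)
        - \<epsilon>' * emp_CVaR n (\<lambda>i. Ys i \<omega>) \<epsilon>' + (\<alpha> + \<epsilon>' - 1) * ?a)} \<in> sets M" by measurable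
      show "AE \<omega> in M. \<omega> \<in> G \<longrightarrow> CVaR MX \<alpha> X \<ge> 1 / \<alpha> * (emp_mean n (\<lambda>i. Ys i \<omega>)
        - \<epsilon>' * emp_CVaR n (\<lambda>i. Ys i \<omega>) \<epsilon>' + (\<alpha> + \<epsilon>' - 1) * ?a)"
        using AE_Y
      proof (eventually_elim, intro impI)
        fix \<omega> assume ge: "\<forall>i\<in>{1..n}. ?a \<le> Ys i \<omega>" and \<omega>: "\<omega> \<in> G"
        interpret cdf_close "?N \<omega>" MX "\<lambda>x. x" X \<epsilon>'
        proof
          show "cdf (distr MX borel X) t - cdf (distr (?N \<omega>) borel (\<lambda>x. x)) t \<le> \<epsilon>'" for t
            using G(3)[OF \<omega>, of t] FXY[rule_format, of t] emp_nonneg[of "\<lambda>i. Ys i \<omega>" t] dX.cdf_bounded_prob[of t]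
            unfolding cdf_N F(1)[symmetric] \<open>\<epsilon>' = _\<close> by (simp add: F(1))
        qed (use X integrable_emp_measure[OF n] \<epsilon>' in auto)
        have "measure_pmf.expectation (map_pmf (\<lambda>i. Ys i \<omega>) (pmf_of_set {1..n})) (\<lambda>x. x)
            - \<epsilon>' * CVaR (?N \<omega>) \<epsilon>' (\<lambda>x. x) + (\<alpha> + \<epsilon>' - 1) * ?a \<le> \<alpha> * CVaR MX \<alpha> X"
          using gt \<alpha> \<epsilon>' AE_X ge by (intro CVaR_lower_mean) (auto simp: AE_emp_measure_iff[OF n])
        then show "CVaR MX \<alpha> X \<ge> 1 / \<alpha> * (emp_mean n (\<lambda>i. Ys i \<omega>)
            - \<epsilon>' * emp_CVaR n (\<lambda>i. Ys i \<omega>) \<epsilon>' + (\<alpha> + \<epsilon>' - 1) * ?a)"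
          unfolding emp_CVaR_eq_CVaR[OF n, symmetric] emp_mean_eq_expectation[OF n, symmetric]
          using \<alpha>(1) by (simp add: pos_divide_le_eq mult.commute)
      qed
    qed
  qed
qed

end
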